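(* Let $m\ge 0$ and $T>0$ be fixed real parameters and let $A:\mathbb{R}\to\mathbb{R}$ be a function of locally bounded variation vanishing on $(-\infty,1)$. Assume that at least one of the following three conditions holds: (1) $A(x)/x$ is boundedly decreasing on $[1,\infty)$; (2) $A(x)/(x\log^{(m-2)_+}x)$ is boundedly decreasing on $[e,\infty)$; (3) $A$ is moderately decreasing on $[1,\infty)$, with constants $B_1,B_2$. Assume further that the Mellin-Stieltjes transform $\mathcal{A}(s):=\int_1^\infty x^{-s}\,dA(x)$ converges in the half plane $\Re s>1$ and that, for some constant $K_1>0$, for all $0<\sigma<1$ $$\int_0^{T}\frac{|\mathcal{A}(1+\sigma+it)|}{|1+\sigma+it|}\,dt\le K_1\begin{cases} Z_m(\sigma,\infty)&\text{if } m>0,\\ Z_0(\sigma,T)&\text{if } m=0.\end{cases}$$ Then there is a constant $C$ such that $|A(x)|\le C\,x\log^{(m-1)_+}x$ for all $x\ge e$ if $m\ne 1$, and $|A(x)|\le C\,x\log\log x$ for all $x\ge e^e$ if $m=1$. Here $C$ depends explicitly only on $m$, on $K_1$ and - under condition (1): on $\sup_{1\le x\le e^{1+50/T}}|A(x)/x|$ and on $\overline{\nu}(A(x)/x;e^{10/T})$; - under condition (2): on $\sup_{1\le x\le e^{1+c/T}}|A(x)/x|$ with $c=10\max(5,\,1+(m-2)_+/\log 2)$ and on $\overline{\nu}(A(x)/(x\log^{(m-2)_+}x);e^{10/T})$; - under condition (3): on $\sup_{1\le x\le e}|A(x)/x|$, on $T$ (more precisely, on $e^{10/T}$) and on $B_1,B_2$;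 and, in case $m=0$, also on $T$ (under each of the three conditions).
   Context: Notation: $r_+=\max(r,0)$. The Stieltjes integral $\int_1^\infty x^{-s}\,dA(x)$ includes the possible jump of $A$ at $1$, so that $\mathcal{A}(s)=s\int_1^\infty A(x)x^{-s-1}\,dx$ for $\Re s>1$. For $m\ge 0$, $\sigma>0$ and $0<T\le\infty$: $Z_m(\sigma,T):=\int_0^T \frac{dt}{|\sigma+it|^m\,|1+\sigma+it|}$. For a real function $f$ on $[a,\infty)$, $a>0$, and $\lambda\ge1$, put $\overline{\nu}(f;\lambda):=-\inf\{f(y)-f(x): a\le x\le y\le\lambda x\}$. The function $f$ is boundedly decreasing on $[a,\infty)$ if $\overline{\nu}(f;\lambda)<\infty$ for some (equivalently, for all) $\lambda>1$. In condition (1) the quantity $\overline\nu$ is taken with $a=1$ and in condition (2) with $a=e$. For $a\ge0$, a real function $F$ on $[a,\infty)$ is moderately decreasing (with constants $B_1,B_2$) if there exist positive constants $B_1,B_2$ such that for all $v\ge0$ and $u\ge a$, $F(u+v)-F(u)\ge -B_1v-B_2\max(1,u)\varphi(u)$, where $\varphi$ is a nonincreasing function on $[a,\infty)$ with $\varphi(x)=1$ for $x\in[a,\max(1,a)]$ and $\lim_{u\to\infty}\varphi(u)=0$. *)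

theory Defs
  imports "HOL-Analysis.Analysis"
begin

definition bounded_variation_on :: "(real \<Rightarrow> real) \<Rightarrow> real \<Rightarrow> real \<Rightarrow> bool" where
  "bounded_variation_on g a b \<longleftrightarrow>
     (\<exists>B. \<forall>d. d division_of {a..b} \<longrightarrow> (\<Sum>K\<in>d. \<bar>g (Sup K) - g (Inf K)\<bar>) \<le> B)"

definition locally_bounded_variation :: "(real \<Rightarrow> real) \<Rightarrow> bool" where
  "locally_bounded_variation g \<longleftrightarrow> (\<forall>a b. a \<le> b \<longrightarrow> bounded_variation_on g a b)"

text \<open>Riemann--Stieltjes integral of \<open>f\<close> against \<open>dg\<close> over \<open>[a,b]\<close>. The gauge is
  a ball of constant radius, so this is the limit of Riemann--Stieltjes sums as the mesh tends
  to 0. Since \<open>g\<close> is evaluated at the endpoints, no one-sided continuity of \<open>g\<close> is needed;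
  the jump of \<open>g\<close> from the left at \<open>a\<close> is not included.\<close>

definition has_stieltjes_integral ::
  "(real \<Rightarrow> complex) \<Rightarrow> (real \<Rightarrow> real) \<Rightarrow> real \<Rightarrow> real \<Rightarrow> complex \<Rightarrow> bool" where
  "has_stieltjes_integral f g a b I \<longleftrightarrow>
     (\<forall>\<epsilon>>0. \<exists>\<delta>>0. \<forall>p. p tagged_division_of {a..b} \<and> (\<lambda>x. ball x \<delta>) fine p \<longrightarrow>
        cmod ((\<Sum>(x, K)\<in>p. f x * of_real (g (Sup K) - g (Inf K))) - I) < \<epsilon>)"

text \<open>The integral of \<open>x\<^sup>-\<^sup>s\<close> against \<open>dA\<close> over \<open>[1,\<infinity>)\<close> as an improper (conditionally convergent)
  integral. For \<open>A\<close> vanishing on \<open>(-\<infinity>,1)\<close> the jump \<open>A(1) - A(1-)\<close> at 1 is \<open>A(1)\<close>; it is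
  included through the summand \<open>A 1\<close>, weighted with \<open>1\<^sup>-\<^sup>s = 1\<close>.\<close>

definition has_mellin_stieltjes :: "(real \<Rightarrow> real) \<Rightarrow> complex \<Rightarrow> complex \<Rightarrow> bool" where
  "has_mellin_stieltjes A s L \<longleftrightarrow>
     (\<exists>I. (\<forall>X\<ge>1. has_stieltjes_integral (\<lambda>x. of_real x powr (- s)) A 1 X (I X)) \<and>
          ((\<lambda>X. of_real (A 1) + I X) \<longlongrightarrow> L) at_top)"

definition mellin_stieltjes :: "(real \<Rightarrow> real) \<Rightarrow> complex \<Rightarrow> complex" where
  "mellin_stieltjes A s = (THE L. has_mellin_stieltjes A s L)"

definition Z_int :: "real \<Rightarrow> real \<Rightarrow> ereal \<Rightarrow> real" where
  "Z_int m \<sigma> T =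
     (LBINT t=0..T. 1 / (cmod (Complex \<sigma> t) powr m * cmod (Complex (1 + \<sigma>) t)))"

definition nu_bar :: "real \<Rightarrow> (real \<Rightarrow> real) \<Rightarrow> real \<Rightarrow> ereal" where
  "nu_bar a f \<mu> =
     - Inf {ereal (f y - f x) | x y. a \<le> x \<and> x \<le> y \<and> y \<le> \<mu> * x}"

definition boundedly_decreasing :: "real \<Rightarrow> (real \<Rightarrow> real) \<Rightarrow> bool" where
  "boundedly_decreasing a f \<longleftrightarrow> (\<exists>\<mu>>1. nu_bar a f \<mu> < \<infinity>)"

definition moderately_decreasing ::
  "real \<Rightarrow> (real \<Rightarrow> real) \<Rightarrow> real \<Rightarrow> real \<Rightarrow> bool" where
  "moderately_decreasing a F B1 B2 \<longleftrightarrow> B1 > 0 \<and> B2 > 0 \<and>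
     (\<exists>\<phi> :: real \<Rightarrow> real. antimono_on {a..} \<phi> \<and> (\<forall>x\<in>{a..max 1 a}. \<phi> x = 1) \<and>
        (\<phi> \<longlongrightarrow> 0) at_top \<and>
        (\<forall>v\<ge>0. \<forall>u\<ge>a. F (u + v) - F u \<ge> - B1 * v - B2 * max 1 u * \<phi> u))"

definition pos_part :: "real \<Rightarrow> real" where
  "pos_part r = max r 0"

definition sup_ratio :: "(real \<Rightarrow> real) \<Rightarrow> real \<Rightarrow> real" where
  "sup_ratio A b = (SUP x\<in>{1..b}. \<bar>A x / x\<bar>)"

definition growth_bound :: "real \<Rightarrow> (real \<Rightarrow> real) \<Rightarrow> real \<Rightarrow> bool" where
  "growth_bound m A C \<longleftrightarrow>
     (if m = 1 then \<forall>x\<ge>exp (exp 1). \<bar>A x\<bar> \<le> C * x * ln (ln x)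
      else \<forall>x\<ge>exp 1. \<bar>A x\<bar> \<le> C * x * ln x powr pos_part (m - 1))"

text \<open>The extra dependence of the constants on \<open>T\<close>, present only for \<open>m = 0\<close>.\<close>

definition T_dep :: "real \<Rightarrow> real \<Rightarrow> real option" where
  "T_dep m T = (if m = 0 then Some T else None)"

end

theory Submission
  imports Defs
begin

text \<open>Put \<open>x = e\<^sup>u\<close> and \<open>a(u) = A(e\<^sup>u) e\<^sup>-\<^sup>u\<close>. Integration by parts turns \<open>\<A>(s)/s\<close> at
  \<open>s = 1 + \<sigma> + it\<close> into the Fourier transform of \<open>a(u) e\<^sup>-\<^sup>\<sigma>\<^sup>u\<close>, so the hypothesis controls the
  means of this function against a Fejer kernel of width \<open>1/T\<close> by \<open>K\<^sub>1 Z\<^sub>m(\<sigma>,\<infinity>)\<close>, which has the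
  claimed order of growth for \<open>\<sigma> = 1/y\<close>. Bounded decrease makes the function keep its size on a
  window of length \<open>10/T\<close> to the right of a large positive value and to the left of a large
  negative one; the window carries most of the mass of the kernel, and the rest is absorbed by
  comparison with the supremum of \<open>|a(u)| e\<^sup>-\<^sup>\<sigma>\<^sup>u\<close>. Under moderate decrease \<open>a\<close> is bounded below,
  and positivity of the kernel suffices.\<close>

section \<open>Mellin--Stieltjes integrals and integration by parts\<close>

text \<open>Each y uses its own \<sigma> = 1/y: there the weight e^(-u/y) equals 1/e at u = y, so a
  bound for the weighted function at y is a bound for a(y). Absorbing the supremum presupposes that
  it is finite. The hypothesis offers only conditional convergence of the Stieltjes integral, and
  after integration by parts the boundary term and the Laplace integral might both be unbounded
  while their sum converges. A comparison argument for a Volterra equation separates them and gives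
  a(u) = O(e^(\<epsilon> u)) for every \<epsilon> > 0; the implied constants serve only finiteness
  and integrability and never reach the final constants. The triangular cutoff in t is chosen for
  the nonnegativity of its kernel, without which a one-sided lower bound could not be integrated.
  Under condition (2) the permitted decrease grows like u^q; the weight holds it below a multiple of
  y^q, and q is at most (m-1)_+, so it stays within the claimed order.\<close>

lemma has_integral_nonneg_lborel:
  fixes f :: "real \<Rightarrow> real"
  assumes [measurable]: "f \<in> borel_measurable borel" "S \<in> sets borel"
    and nn: "\<And>x. x \<in> S \<Longrightarrow> f x \<ge> 0" and I: "(f has_integral I) S"
  shows "set_integrable lborel S f" and "(LINT x:S|lborel. f x) = I"
proof -
  have "f absolutely_integrable_on S"
    using I nn by (intro nonnegative_absolutely_integrable_1) auto
  then show *: "set_integrable lborel S f"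
    unfolding set_integrable_def by (subst (asm) integrable_completion) auto
  show "(LINT x:S|lborel. f x) = I"
    using set_borel_integral_eq_integral(2)[OF *] I by (simp add: integral_unique)
qed

text \<open>\<open>V\<close> is the total variation on [a,x]: appending [x,y] as one more cell to a
  division of [a,x] adds |A y - A x| to its sum. Bounded variation is used later only through this
  inequality.\<close>

lemma variation_dominates_increments:
  fixes A :: "real \<Rightarrow> real"
  assumes "locally_bounded_variation A"
  obtains V where "\<And>x y. a \<le> x \<Longrightarrow> x \<le> y \<Longrightarrow> \<bar>A y - A x\<bar> \<le> V y - V x"
proof -
  define S where "S d = (\<Sum>K\<in>d. \<bar>A (Sup K) - A (Inf K)\<bar>)" for d
  define V where "V x = (SUP d\<in>{d. d division_of {a..x}}. S d)" for x
  have bdd: "bdd_above (S ` {d. d division_of {a..x}})" if "a \<le> x" for x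
    using assms that unfolding locally_bounded_variation_def bounded_variation_on_def S_def bdd_above_def
    by (metis (mono_tags, lifting) imageE mem_Collect_eq)
  have ex: "{d. d division_of {a..x}} \<noteq> {}" for x
    using elementary_interval[of a x] by auto
  have "\<bar>A y - A x\<bar> \<le> V y - V x" if xy: "a \<le> x" "x \<le> y" for x y
  proof (cases "x = y")
    case False
    with xy have lt: "x < y" by simp
    have "S d \<le> V y - \<bar>A y - A x\<bar>" if d: "d division_of {a..x}" for d
    proof -
      have "d \<union> {{x..y}} division_of {a..x} \<union> {x..y}"
      proof (rule division_disjoint_union[OF d])
        show "{{x..y}} division_of {x..y}"
          using division_of_self[of x y] lt by simp
        show "interior {a..x} \<inter> interior {x..y} = {}" by auto
      qed
      moreover have "{a..x} \<union> {x..y} = {a..y}" using xy by auto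
      ultimately have d': "d \<union> {{x..y}} division_of {a..y}" by simp
      \<comment> \<open>A division is a set of cells, so a cell already present would contribute no
        new term.\<close>
      have notin: "{x..y} \<notin> d"
      proof
        assume "{x..y} \<in> d"
        then have "{x..y} \<subseteq> {a..x}" using d by (auto dest: division_ofD)
        then show False using lt by auto
      qed
      have "S (d \<union> {{x..y}}) = S d + \<bar>A y - A x\<bar>"
        using notin division_of_finite[OF d] lt by (simp add: S_def)
      moreover have "S (d \<union> {{x..y}}) \<le> V y"
        unfolding V_def by (rule cSUP_upper) (use d' bdd[of y] xy in auto)
      ultimately show ?thesis by simp
    qed
    then have "V x \<le> V y - \<bar>A y - A x\<bar>"
      unfolding V_def[of x] using ex by (intro cSUP_least) auto
    then show ?thesis by simp
  qed simp
  then show ?thesis by (rule that)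
qed

text \<open>Jordan decomposition: \<open>V\<close> and \<open>V - A\<close> are nondecreasing.
  Clamping the argument to [a,\<infinity>) makes them monotone on the whole line, hence
  Borel.\<close>

lemma dominated_increments_measurable:
  fixes A V :: "real \<Rightarrow> real"
  assumes V: "\<And>x y. a \<le> x \<Longrightarrow> x \<le> y \<Longrightarrow> \<bar>A y - A x\<bar> \<le> V y - V x"
    and z: "\<And>x. x < a \<Longrightarrow> A x = 0"
  shows "A \<in> borel_measurable borel"
proof -
  have m: "mono (\<lambda>x. V (max a x))" "mono (\<lambda>x. V (max a x) - A (max a x))"
  proof -
    have *: "\<bar>A (max a y) - A (max a x)\<bar> \<le> V (max a y) - V (max a x)" if "x \<le> y" for x y
      using that by (intro V) auto
    show "mono (\<lambda>x. V (max a x))" using * by (intro monoI) (smt (verit))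
    show "mono (\<lambda>x. V (max a x) - A (max a x))" using * by (intro monoI) (smt (verit))
  qed
  then have "(\<lambda>x. V (max a x) - (V (max a x) - A (max a x))) \<in> borel_measurable borel"
    by (intro borel_measurable_diff borel_measurable_mono)
  then have "(\<lambda>x. indicator {a..} x * A (max a x)) \<in> borel_measurable borel"
    by simp
  moreover have "(\<lambda>x. indicator {a..} x * A (max a x)) = A"
    using z by (auto simp: indicator_def fun_eq_iff)
  ultimately show ?thesis by simp
qed

lemma has_stieltjes_integral_unique:
  assumes "has_stieltjes_integral f g a b I" "has_stieltjes_integral f g a b J"
  shows "I = J"
proof (rule ccontr)
  assume "I \<noteq> J"
  define e where "e = cmod (I - J) / 2"
  have "e > 0" using \<open>I \<noteq> J\<close> by (simp add: e_def)
  define R where "R p = (\<Sum>(x, K)\<in>p. f x * complex_of_real (g (Sup K) - g (Inf K)))" for p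
  obtain d1 where d1: "d1 > 0"
    "\<forall>p. p tagged_division_of {a..b} \<and> (\<lambda>x. ball x d1) fine p \<longrightarrow> cmod (R p - I) < e"
    using assms(1)[unfolded has_stieltjes_integral_def, folded R_def] \<open>e > 0\<close> by auto
  obtain d2 where d2: "d2 > 0"
    "\<forall>p. p tagged_division_of {a..b} \<and> (\<lambda>x. ball x d2) fine p \<longrightarrow> cmod (R p - J) < e"
    using assms(2)[unfolded has_stieltjes_integral_def, folded R_def] \<open>e > 0\<close> by auto
  \<comment> \<open>Cousin's lemma supplies a division fine for both radii, on which the two limits
    are compared.\<close>
  have "gauge (\<lambda>x::real. ball x (min d1 d2))"
    using d1(1) d2(1) by (intro gauge_ball) simp
  then obtain p where p: "p tagged_division_of {a..b}" "(\<lambda>x. ball x (min d1 d2)) fine p"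
    by (rule fine_division_exists_real)
  have "ball x (min d1 d2) \<subseteq> ball x d1" "ball x (min d1 d2) \<subseteq> ball x d2" for x :: real
    by (intro subset_ball; simp)+
  then have "(\<lambda>x. ball x d1) fine p" "(\<lambda>x. ball x d2) fine p"
    using p(2) unfolding fine_def by fast+
  then have "cmod (R p - I) < e" "cmod (R p - J) < e"
    using d1(2) d2(2) p(1) by simp_all
  then have "cmod (I - J) < e + e"
    using norm_diff_triangle_less norm_minus_commute by metis
  then show False by (simp add: e_def)
qed

text \<open>\<open>J\<close> reproduces the increments of the Stieltjes integral up to an error of
  second order, so in a Riemann-Stieltjes sum the increments of \<open>J\<close> telescope and the
  errors add up to at most mesh times variation. The Lipschitz bound on \<open>f\<close> moves each
  tag to the left endpoint of its cell.\<close>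

lemma has_stieltjes_integral_primitive:
  fixes f :: "real \<Rightarrow> complex" and A V :: "real \<Rightarrow> real"
  assumes ab: "a \<le> b" and F: "F \<ge> 0"
    and V: "\<And>x y. a \<le> x \<Longrightarrow> x \<le> y \<Longrightarrow> \<bar>A y - A x\<bar> \<le> V y - V x"
    and f: "\<And>x y. a \<le> x \<Longrightarrow> x \<le> y \<Longrightarrow> y \<le> b \<Longrightarrow> cmod (f y - f x) \<le> F * (y - x)"
    and J: "\<And>x y. a \<le> x \<Longrightarrow> x \<le> y \<Longrightarrow> y \<le> b \<Longrightarrow>
              cmod (J y - J x - f x * of_real (A y - A x)) \<le> F * (y - x) * (V y - V x)"
  shows "has_stieltjes_integral f A a b (J b - J a)"
  unfolding has_stieltjes_integral_def
proof (intro allI impI)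
  fix e :: real assume e: "e > 0"
  define W where "W = V b - V a"
  have W: "W \<ge> 0" using V[of a b] ab by (simp add: W_def)
  \<comment> \<open>A cell inside a ball of radius d has length at most 2d; the tag shift and the
    error of \<open>J\<close> each cost F times length times variation, in total 4 F d W. The
    summand 1 avoids division by zero.\<close>
  define d where "d = e / (4 * F * W + 1)"
  have pos: "4 * F * W + 1 > 0" using F W by (simp add: add_nonneg_pos)
  have d: "d > 0" using e pos by (simp add: d_def)
  have "cmod ((\<Sum>(x, K)\<in>p. f x * of_real (A (Sup K) - A (Inf K))) - (J b - J a)) < e"
    if p: "p tagged_division_of {a..b}" "(\<lambda>x. ball x d) fine p" for p
  proof -
    have 1: "cmod (f t * of_real (A (Sup K) - A (Inf K)) - (J (Sup K) - J (Inf K)))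
               \<le> 4 * F * d * (V (Sup K) - V (Inf K))" if tK: "(t, K) \<in> p" for t K
    proof -
      obtain x y where K: "K = {x..y}" and t: "t \<in> K"
        using tagged_division_ofD(2,4)[OF p(1) tK] by auto
      then have xy: "x \<le> t" "t \<le> y" by auto
      have sub: "K \<subseteq> {a..b}" using tagged_division_ofD(3)[OF p(1) tK] .
      then have ax: "a \<le> x" "y \<le> b" using xy K by auto
      have "K \<subseteq> ball t d" using p(2) tK unfolding fine_def by auto
      moreover have "x \<in> K" "y \<in> K" using K xy by auto
      ultimately have "x \<in> ball t d" "y \<in> ball t d" by blast+
      then have len: "y - x \<le> 2 * d" by (auto simp: dist_real_def)
      have SI: "Sup K = y" "Inf K = x" using K xy by auto
      have dV: "V y - V x \<ge> 0" "\<bar>A y - A x\<bar> \<le> V y - V x" using V[of x y] ax xy by auto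
      have "cmod (f t * of_real (A y - A x) - (J y - J x))
          = cmod ((f t - f x) * of_real (A y - A x) - (J y - J x - f x * of_real (A y - A x)))"
        by (simp add: algebra_simps)
      also have "\<dots> \<le> cmod (f t - f x) * \<bar>A y - A x\<bar> + F * (y - x) * (V y - V x)"
        using norm_triangle_ineq4 J[of x y] ax xy
        by (smt (verit, best) norm_mult norm_of_real)
      also have "cmod (f t - f x) * \<bar>A y - A x\<bar> \<le> (F * (y - x)) * (V y - V x)"
      proof (rule mult_mono)
        have "cmod (f t - f x) \<le> F * (t - x)" using f[of x t] ax xy by simp
        also have "\<dots> \<le> F * (y - x)" using xy F by (intro mult_left_mono) auto
        finally show "cmod (f t - f x) \<le> F * (y - x)" .
      qed (use dV F xy in auto)
      also have "(F * (y - x)) * (V y - V x) + F * (y - x) * (V y - V x)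
          = (y - x) * (2 * F * (V y - V x))" by (simp add: algebra_simps)
      also have "\<dots> \<le> 2 * d * (2 * F * (V y - V x))"
        using len dV F by (intro mult_right_mono) auto
      finally show ?thesis by (simp add: SI algebra_simps)
    qed
    have telJ: "(\<Sum>(x, K)\<in>p. J (Sup K) - J (Inf K)) = J b - J a"
      and telV: "(\<Sum>(x, K)\<in>p. V (Sup K) - V (Inf K)) = V b - V a"
      using additive_tagged_division_1[OF ab p(1)] by auto
    have "(\<Sum>(x, K)\<in>p. f x * of_real (A (Sup K) - A (Inf K))) - (J b - J a)
        = (\<Sum>(x, K)\<in>p. f x * of_real (A (Sup K) - A (Inf K)) - (J (Sup K) - J (Inf K)))"
      unfolding telJ[symmetric] by (simp add: sum_subtractf case_prod_beta)
    also have "cmod \<dots> \<le> (\<Sum>(x, K)\<in>p. 4 * F * d * (V (Sup K) - V (Inf K)))"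
      by (rule sum_norm_le) (use 1 in auto)
    also have "\<dots> = 4 * F * d * W"
      unfolding W_def telV[symmetric] by (simp add: sum_distrib_left case_prod_beta)
    also have "\<dots> < e"
      using pos e F W by (simp add: d_def divide_simps algebra_simps)
    finally show ?thesis .
  qed
  then show "\<exists>\<delta>>0. \<forall>p. p tagged_division_of {a..b} \<and> (\<lambda>x. ball x \<delta>) fine p \<longrightarrow>
        cmod ((\<Sum>(x, K)\<in>p. f x * of_real (A (Sup K) - A (Inf K))) - (J b - J a)) < e"
    using d by blast
qed

lemma dominated_increments_bounded:
  fixes A V :: "real \<Rightarrow> real"
  assumes V: "\<And>x y. a \<le> x \<Longrightarrow> x \<le> y \<Longrightarrow> \<bar>A y - A x\<bar> \<le> V y - V x"
    and x: "a \<le> x" "x \<le> X"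
  shows "\<bar>A x\<bar> \<le> \<bar>A a\<bar> + (V X - V a)"
  using V[of a x] V[of x X] x by auto

lemma exp_integral_complex:
  fixes s :: complex
  assumes "p \<le> q"
  shows "((\<lambda>u. - s * exp (- (s * of_real u))) has_integral
           exp (- (s * of_real q)) - exp (- (s * of_real p))) {p..q}"
  by (rule fundamental_theorem_of_calculus[OF assms])
     (auto intro!: derivative_eq_intros has_vector_derivative_real_field)

text \<open>Integration by parts, by checking that the right-hand side as a function of X meets the
  criterion of \<open>has_stieltjes_integral_primitive\<close>. In the variable u = ln x the powers
  become exponentials, which Re s \<ge> 0 bounds by 1.\<close>

lemma has_stieltjes_integral_powr:
  fixes A V :: "real \<Rightarrow> real" and s :: complex
  assumes V: "\<And>x y. 1 \<le> x \<Longrightarrow> x \<le> y \<Longrightarrow> \<bar>A y - A x\<bar> \<le> V y - V x"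
    and z: "\<And>x. x < 1 \<Longrightarrow> A x = 0"
    and s: "Re s \<ge> 0" and X: "X \<ge> 1"
  shows "(\<lambda>u. of_real (A (exp u)) * exp (- (s * of_real u))) integrable_on {0..ln X}"
    and "has_stieltjes_integral (\<lambda>x. of_real x powr (- s)) A 1 X
      (of_real X powr (- s) * of_real (A X) - of_real (A 1)
        + s * integral {0..ln X} (\<lambda>u. of_real (A (exp u)) * exp (- (s * of_real u))))"
proof -
  define h :: "real \<Rightarrow> complex" where "h u = of_real (A (exp u)) * exp (- (s * of_real u))" for u
  have meas[measurable]: "A \<in> borel_measurable borel"
    using dominated_increments_measurable[OF V z] .
  have ne: "cmod (exp (- (s * of_real u))) \<le> 1" if "u \<ge> 0" for u
    using s that by simp
  have int: "h integrable_on {p..q}" if "0 \<le> p" for p q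
  proof -
    have "set_integrable lborel {p..q} h"
      unfolding set_integrable_def
    proof (rule integrableI_bounded_set_indicator[where B = "\<bar>A 1\<bar> + (V (exp q) - V 1)"])
      show "AE x in lborel. x \<in> {p..q} \<longrightarrow> cmod (h x) \<le> \<bar>A 1\<bar> + (V (exp q) - V 1)"
      proof (rule AE_I2, rule impI)
        fix u assume u: "u \<in> {p..q}"
        have "cmod (h u) \<le> \<bar>A (exp u)\<bar> * 1"
          unfolding h_def norm_mult using ne[of u] u that by (intro mult_mono) auto
        also have "\<dots> \<le> \<bar>A 1\<bar> + (V (exp q) - V 1)"
          using dominated_increments_bounded[of 1 A V "exp u" "exp q"] V u that by auto
        finally show "cmod (h u) \<le> \<bar>A 1\<bar> + (V (exp q) - V 1)" .
      qed
    qed (auto simp: h_def emeasure_lborel_Icc_eq)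
    then show ?thesis by (rule set_borel_integral_eq_integral)
  qed
  show "h integrable_on {0..ln X}" using int by simp
  define f :: "real \<Rightarrow> complex" where "f x = of_real x powr (- s)" for x
  define J where "J x = f x * of_real (A x) + s * integral {0..ln x} h" for x
  have f: "f x = exp (- (s * of_real (ln x)))" if "x \<ge> 1" for x
    using that by (simp add: f_def powr_def Ln_of_real)
  have lnlip: "ln y - ln x \<le> y - x" if "1 \<le> x" "x \<le> y" for x y :: real
  proof -
    have "ln y - ln x = ln (y / x)" using that by (simp add: ln_div)
    also have "\<dots> \<le> y / x - 1" using that by (intro ln_le_minus_one) auto
    also have "\<dots> = (y - x) / x" using that by (simp add: field_simps)
    also have "\<dots> \<le> (y - x) / 1" using that by (intro divide_left_mono) auto
    finally show ?thesis by simp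
  qed
  have lip: "cmod (f y - f x) \<le> cmod s * (y - x)" if "1 \<le> x" "x \<le> y" for x y
  proof -
    have l: "0 \<le> ln x" "ln x \<le> ln y" using that by auto
    note I = exp_integral_complex[OF l(2), of s]
    have "cmod (f y - f x) = cmod (integral {ln x..ln y} (\<lambda>u. - s * exp (- (s * of_real u))))"
      using f[of x] f[of y] that unfolding integral_unique[OF I] by simp
    also have "\<dots> \<le> integral {ln x..ln y} (\<lambda>u. cmod s)"
    proof (rule integral_norm_bound_integral)
      show "(\<lambda>u. - s * exp (- (s * of_real u))) integrable_on {ln x..ln y}" using I by blast
      fix u assume "u \<in> {ln x..ln y}"
      then have "cmod s * cmod (exp (- (s * of_real u))) \<le> cmod s * 1"
        using l ne[of u] by (intro mult_left_mono) auto
      then show "cmod (- s * exp (- (s * of_real u))) \<le> cmod s"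
        by (simp only: norm_mult norm_minus_cancel mult_1_right)
    qed (rule integrable_const_ivl)
    also have "\<dots> = cmod s * (ln y - ln x)" using l by simp
    also have "\<dots> \<le> cmod s * (y - x)" using lnlip that by (intro mult_left_mono) auto
    finally show ?thesis .
  qed
  have Jinc: "cmod (J y - J x - f x * of_real (A y - A x)) \<le> cmod s * (y - x) * (V y - V x)"
    if xy: "1 \<le> x" "x \<le> y" for x y
  proof -
    have l: "0 \<le> ln x" "ln x \<le> ln y" using xy by auto
    note I = exp_integral_complex[OF l(2), of s]
    have I': "((\<lambda>u. of_real (A y) * (- s * exp (- (s * of_real u)))) has_integral
        of_real (A y) * (f y - f x)) {ln x..ln y}"
      using has_integral_mult_right[OF I, of "of_real (A y)"] xy by (simp add: f)
    have H: "((\<lambda>u. s * h u) has_integral s * integral {ln x..ln y} h) {ln x..ln y}"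
      using int[OF l(1)] by (intro has_integral_mult_right) auto
    have comb: "integral {0..ln y} h = integral {0..ln x} h + integral {ln x..ln y} h"
      using Henstock_Kurzweil_Integration.integral_combine[of 0 "ln x" "ln y" h] l int by simp
    \<comment> \<open>As f y - f x is the integral of -s e^(-su) over [ln x, ln y], both terms
      combine to s times the integral of (A(e^u) - A y) e^(-su). The difference of values of
      \<open>A\<close> is at most V y - V x, which makes the error second order.\<close>
    have "J y - J x - f x * of_real (A y - A x)
        = of_real (A y) * (f y - f x) + s * integral {ln x..ln y} h"
      by (simp add: J_def comb algebra_simps)
    also have "\<dots> = integral {ln x..ln y} (\<lambda>u. of_real (A y) * (- s * exp (- (s * of_real u))) + s * h u)"
      using has_integral_add[OF I' H] by (simp add: integral_unique)
    also have "cmod \<dots> \<le> integral {ln x..ln y} (\<lambda>u. cmod s * (V y - V x))"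
    proof (rule integral_norm_bound_integral)
      show "(\<lambda>u. of_real (A y) * (- s * exp (- (s * of_real u))) + s * h u) integrable_on {ln x..ln y}"
        using has_integral_add[OF I' H] by blast
      fix u assume u: "u \<in> {ln x..ln y}"
      then have eu: "x \<le> exp u" "exp u \<le> y"
        using xy exp_le_cancel_iff[of "ln x" u] exp_le_cancel_iff[of u "ln y"] by auto
      have "of_real (A y) * (- s * exp (- (s * of_real u))) + s * h u
          = s * (of_real (A (exp u) - A y) * exp (- (s * of_real u)))"
        by (simp add: h_def algebra_simps)
      also have "cmod \<dots> = cmod s * (\<bar>A (exp u) - A y\<bar> * cmod (exp (- (s * of_real u))))"
        by (simp only: norm_mult norm_of_real)
      also have "\<dots> \<le> cmod s * ((V y - V x) * 1)"
      proof (intro mult_left_mono mult_mono)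
        have u0: "0 \<le> u" using u l by simp
        then show "cmod (exp (- (s * of_real u))) \<le> 1" by (rule ne)
        show "\<bar>A (exp u) - A y\<bar> \<le> V y - V x"
          using V[of "exp u" y] V[of x "exp u"] eu xy u0 by simp
      qed (use V[OF xy] in auto)
      finally show "cmod (of_real (A y) * (- s * exp (- (s * of_real u))) + s * h u) \<le> cmod s * (V y - V x)"
        by simp
    qed (rule integrable_const_ivl)
    also have "\<dots> = cmod s * (V y - V x) * (ln y - ln x)" using l by simp
    also have "\<dots> \<le> cmod s * (V y - V x) * (y - x)"
      using lnlip xy V[of x y] by (intro mult_left_mono) auto
    finally show ?thesis by (simp add: algebra_simps)
  qed
  have "has_stieltjes_integral f A 1 X (J X - J 1)"
    by (rule has_stieltjes_integral_primitive[where F = "cmod s" and V = V])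
       (use X V lip Jinc in auto)
  moreover have "J 1 = of_real (A 1)" by (simp add: J_def f)
  ultimately show "has_stieltjes_integral (\<lambda>x. of_real x powr (- s)) A 1 X
      (of_real X powr (- s) * of_real (A X) - of_real (A 1)
        + s * integral {0..ln X} (\<lambda>u. of_real (A (exp u)) * exp (- (s * of_real u))))"
    by (simp add: J_def f_def[abs_def] h_def[abs_def] algebra_simps)
qed

section \<open>Growth of A and the Laplace transform\<close>

text \<open>Above the level G the function \<beta> = s \<integral> \<alpha> cannot increase, because
  there \<alpha> \<le> G - \<beta> < 0. The last point with \<beta> \<le> G replaces a differential
  inequality, since \<alpha> is merely integrable.\<close>

lemma volterra_upper_bound:
  fixes \<alpha> :: "real \<Rightarrow> real"
  assumes int: "\<And>u. u \<ge> 0 \<Longrightarrow> \<alpha> integrable_on {0..u}" and s: "s > 0" and G: "G \<ge> 0"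
    and le: "\<And>u. u \<ge> 0 \<Longrightarrow> \<alpha> u + s * integral {0..u} \<alpha> \<le> G"
    and v: "v \<ge> 0"
  shows "s * integral {0..v} \<alpha> \<le> G"
proof (rule ccontr)
  define \<beta> where "\<beta> u = s * integral {0..u} \<alpha>" for u
  assume "\<not> ?thesis"
  then have gt: "\<beta> v > G" by (simp add: \<beta>_def)
  define P where "P = {u \<in> {0..v}. \<beta> u \<le> G}"
  have cont: "continuous_on {0..v} \<beta>"
    unfolding \<beta>_def by (intro continuous_intros indefinite_integral_continuous_1 int v)
  have "closed P"
    unfolding P_def by (rule continuous_on_closed_Collect_le) (use cont in auto)
  moreover have "bounded P" unfolding P_def by (rule bounded_subset[of "{0..v}"]) auto
  ultimately have comp: "compact P" by (simp add: compact_eq_bounded_closed)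
  have "0 \<in> P" using v G by (simp add: P_def \<beta>_def)
  then obtain w where w: "w \<in> P" "\<And>u. u \<in> P \<Longrightarrow> u \<le> w"
    using compact_attains_sup[OF comp] by blast
  have w0: "0 \<le> w" "w \<le> v" "\<beta> w \<le> G" using w(1) by (auto simp: P_def)
  have neg: "\<alpha> u \<le> 0" if "w < u" "u \<le> v" for u
    using le[of u] w(2)[of u] that w0 by (fastforce simp: P_def \<beta>_def)
  have intw: "\<alpha> integrable_on {w..v}"
    using integrable_subinterval_real[OF int[OF v]] w0 by auto
  \<comment> \<open>The sign of \<alpha> is known only to the right of w; one point does not affect
    the integral.\<close>
  have "integral {w..v} \<alpha> = integral {w..v} (\<lambda>u. if u = w then 0 else \<alpha> u)"
    by (rule integral_spike[of "{w}"]) auto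
  also have "\<dots> \<le> integral {w..v} (\<lambda>u. 0)"
  proof (rule integral_le)
    show "(\<lambda>u. if u = w then 0 else \<alpha> u) integrable_on {w..v}"
      by (rule integrable_spike[OF intw, of "{w}"]) auto
  qed (use neg in auto)
  finally have "integral {w..v} \<alpha> \<le> 0" by simp
  moreover have "integral {0..v} \<alpha> = integral {0..w} \<alpha> + integral {w..v} \<alpha>"
    using Henstock_Kurzweil_Integration.integral_combine[of 0 w v \<alpha>] w0 int[OF v] by simp
  ultimately have "\<beta> v \<le> \<beta> w" using s by (simp add: \<beta>_def)
  then show False using gt w0 by simp
qed

lemma volterra_bound:
  fixes \<alpha> :: "real \<Rightarrow> real"
  assumes int: "\<And>u. u \<ge> 0 \<Longrightarrow> \<alpha> integrable_on {0..u}" and s: "s > 0"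
    and le: "\<And>u. u \<ge> 0 \<Longrightarrow> \<bar>\<alpha> u + s * integral {0..u} \<alpha>\<bar> \<le> G"
    and v: "v \<ge> 0"
  shows "\<bar>\<alpha> v\<bar> \<le> 2 * G"
proof -
  have G: "G \<ge> 0" using le[of 0] by simp
  have 1: "s * integral {0..v} \<alpha> \<le> G"
    by (rule volterra_upper_bound[OF int s G _ v]) (use le in \<open>auto simp: abs_le_iff\<close>)
  have "s * integral {0..v} (\<lambda>u. - \<alpha> u) \<le> G"
  proof (rule volterra_upper_bound[OF _ s G _ v])
    fix u :: real assume "u \<ge> 0"
    then show "- \<alpha> u + s * integral {0..u} (\<lambda>u. - \<alpha> u) \<le> G"
      using le[of u] by (simp add: abs_le_iff)
  qed (use int in \<open>auto intro: integrable_neg\<close>)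
  with 1 le[OF v] show ?thesis by (simp add: abs_le_iff)
qed

lemma exp_decay_set_integrable:
  fixes a :: real
  assumes "a > 0"
  shows "set_integrable lborel {0..} (\<lambda>u. exp (- a * u))"
proof -
  have "((\<lambda>u. exp (- a * u)) has_integral exp (- a * 0) / a) {0..}"
    by (rule has_integral_exp_minus_to_infinity[OF assms])
  then show ?thesis by (intro has_integral_nonneg_lborel) auto
qed

text \<open>By parts, the partial integrals are \<alpha> + s \<integral> \<alpha> with \<alpha>(u) =
  A(e^u) e^(-su), and convergence bounds them. Cancellation could still hide growth of both terms;
  \<open>volterra_bound\<close> excludes it.\<close>

lemma mellin_summatory_growth:
  fixes A :: "real \<Rightarrow> real"
  assumes bv: "locally_bounded_variation A" and z: "\<And>x. x < 1 \<Longrightarrow> A x = 0"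
    and s: "s > 0" and L: "has_mellin_stieltjes A (of_real s) L"
  shows "\<exists>C. \<forall>u\<ge>0. \<bar>A (exp u)\<bar> \<le> C * exp (s * u)"
proof -
  obtain V where V: "\<And>x y. 1 \<le> x \<Longrightarrow> x \<le> y \<Longrightarrow> \<bar>A y - A x\<bar> \<le> V y - V x"
    using variation_dominates_increments[OF bv] by blast
  define \<alpha> where "\<alpha> u = A (exp u) * exp (- (s * u))" for u
  define h :: "real \<Rightarrow> complex" where "h u = of_real (A (exp u)) * exp (- (of_real s * of_real u))" for u
  have h: "h u = of_real (\<alpha> u)" for u
    by (simp add: h_def \<alpha>_def exp_of_real flip: of_real_mult of_real_minus)
  have hint: "h integrable_on {0..u}" if "u \<ge> 0" for u
    using has_stieltjes_integral_powr(1)[OF V z, where s = "of_real s" and X = "exp u"] s that by (simp add: h_def[abs_def])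
  have ai: "\<alpha> integrable_on {0..u}" if "u \<ge> 0" for u
    using integrable_linear[OF hint[OF that] bounded_linear_Re] by (simp add: o_def h)
  have Reh: "Re (integral {0..u} h) = integral {0..u} \<alpha>" if "u \<ge> 0" for u
    using integral_linear[OF hint[OF that] bounded_linear_Re] by (simp add: o_def h)
  define g where "g u = \<alpha> u + s * integral {0..u} \<alpha>" for u
  obtain I where I: "\<And>X. X \<ge> 1 \<Longrightarrow> has_stieltjes_integral (\<lambda>x. of_real x powr (- of_real s)) A 1 X (I X)"
    and lim: "((\<lambda>X. of_real (A 1) + I X) \<longlongrightarrow> L) at_top"
    using L unfolding has_mellin_stieltjes_def by blast
  have Ieq: "of_real (A 1) + I X = of_real X powr (- of_real s) * of_real (A X) + of_real s * integral {0..ln X} h"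
    if "X \<ge> 1" for X
    using has_stieltjes_integral_unique[OF I[OF that] has_stieltjes_integral_powr(2)[OF V z, where s = "of_real s" and X = X]] s that
    by (simp add: h_def[abs_def])
  have geq: "g (ln X) = Re (of_real (A 1) + I X)" if "X \<ge> 1" for X
  proof -
    have "of_real X powr (- of_real s) * of_real (A X) = h (ln X)"
      using that by (simp add: h_def powr_def Ln_of_real)
    then have "of_real (A 1) + I X = of_real (\<alpha> (ln X)) + of_real s * integral {0..ln X} h"
      using Ieq[OF that] by (simp add: h)
    then show ?thesis using that by (simp add: g_def Reh)
  qed
  have "eventually (\<lambda>X. dist (of_real (A 1) + I X) L < 1) at_top"
    using lim by (rule tendstoD) simp
  then obtain X0 where X0: "\<And>X. X \<ge> X0 \<Longrightarrow> dist (of_real (A 1) + I X) L < 1"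
    unfolding eventually_at_top_linorder by blast
  \<comment> \<open>Beyond U the partial integrals are within 1 of the limit; on [0,U] the bounded
    variation of \<open>A\<close> controls them.\<close>
  define U where "U = ln (max 1 X0)"
  have U: "U \<ge> 0" "exp U = max 1 X0" by (auto simp: U_def)
  have big: "\<bar>g u\<bar> \<le> cmod L + 1" if "u \<ge> U" for u
  proof -
    have "exp U \<le> exp u" using that by simp
    then have X: "exp u \<ge> 1" "exp u \<ge> X0" unfolding U by auto
    have "\<bar>g u\<bar> \<le> cmod (of_real (A 1) + I (exp u))"
      using geq[OF X(1)] abs_Re_le_cmod by (simp del: plus_complex.sel)
    also have "\<dots> \<le> cmod L + dist (of_real (A 1) + I (exp u)) L"
      unfolding dist_norm by (metis add.commute norm_triangle_sub)
    finally show ?thesis using X0[OF X(2)] by simp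
  qed
  define B where "B = \<bar>A 1\<bar> + (V (exp U) - V 1)"
  have B: "\<bar>\<alpha> u\<bar> \<le> B" if "0 \<le> u" "u \<le> U" for u
  proof -
    have "\<bar>\<alpha> u\<bar> \<le> \<bar>A (exp u)\<bar> * 1"
      unfolding \<alpha>_def abs_mult using s that by (intro mult_left_mono) auto
    then show ?thesis
      using dominated_increments_bounded[of 1 A V "exp u" "exp U"] V that by (auto simp: B_def)
  qed
  have B0: "B \<ge> 0" using B[of 0] U by auto
  have small: "\<bar>g u\<bar> \<le> B + s * (B * U)" if "0 \<le> u" "u \<le> U" for u
  proof -
    have "\<bar>integral {0..u} \<alpha>\<bar> \<le> integral {0..u} (\<lambda>_. B)"
      using integral_norm_bound_integral[OF ai[OF that(1)], of "\<lambda>_. B"] B that by auto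
    also have "\<dots> \<le> B * U" using that B0 by (simp add: mult.commute[of u] mult_left_mono)
    finally have "s * \<bar>integral {0..u} \<alpha>\<bar> \<le> s * (B * U)" using s by (intro mult_left_mono) auto
    then have "\<bar>s * integral {0..u} \<alpha>\<bar> \<le> s * (B * U)" using s by (simp only: abs_mult abs_of_pos)
    then show ?thesis using B[OF that] unfolding g_def by linarith
  qed
  define G where "G = max (cmod L + 1) (B + s * (B * U))"
  have G: "\<bar>\<alpha> u + s * integral {0..u} \<alpha>\<bar> \<le> G" if "u \<ge> 0" for u
    using big[of u] small[of u] that unfolding G_def g_def by linarith
  have "\<bar>A (exp u)\<bar> \<le> 2 * G * exp (s * u)" if "u \<ge> 0" for u
  proof -
    have "\<bar>\<alpha> u\<bar> \<le> 2 * G" using volterra_bound[OF ai s G that] .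
    then have "\<bar>\<alpha> u\<bar> * exp (s * u) \<le> 2 * G * exp (s * u)" by (intro mult_right_mono) auto
    moreover have "\<bar>\<alpha> u\<bar> * exp (s * u) = \<bar>A (exp u)\<bar>"
      by (simp add: \<alpha>_def abs_mult mult.assoc flip: exp_add)
    ultimately show ?thesis by simp
  qed
  then show ?thesis by blast
qed

text \<open>The growth exponent r below Re s does two things: the Laplace integral converges
  absolutely, and the boundary term X^(-s) A(X) tends to 0.\<close>

lemma mellin_stieltjes_eq_laplace:
  fixes A :: "real \<Rightarrow> real" and s :: complex
  assumes bv: "locally_bounded_variation A" and z: "\<And>x. x < 1 \<Longrightarrow> A x = 0"
    and r: "0 < r" "r < Re s" and C: "\<And>u. u \<ge> 0 \<Longrightarrow> \<bar>A (exp u)\<bar> \<le> C * exp (r * u)"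
    and ex: "\<exists>L. has_mellin_stieltjes A s L"
  shows "set_integrable lborel {0..} (\<lambda>u. of_real (A (exp u)) * exp (- (s * of_real u)))"
    and "mellin_stieltjes A s
      = s * (LINT u:{0..}|lborel. of_real (A (exp u)) * exp (- (s * of_real u)))"
proof -
  obtain V where V: "\<And>x y. 1 \<le> x \<Longrightarrow> x \<le> y \<Longrightarrow> \<bar>A y - A x\<bar> \<le> V y - V x"
    using variation_dominates_increments[OF bv] by blast
  have [measurable]: "A \<in> borel_measurable borel"
    using dominated_increments_measurable[OF V z] .
  define h :: "real \<Rightarrow> complex" where "h u = of_real (A (exp u)) * exp (- (s * of_real u))" for u
  have hb: "cmod (h u) \<le> C * exp (- (Re s - r) * u)" if "u \<ge> 0" for u
  proof -
    have "cmod (h u) = \<bar>A (exp u)\<bar> * exp (- (Re s * u))" by (simp add: h_def norm_mult)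
    also have "\<dots> \<le> C * exp (r * u) * exp (- (Re s * u))"
      using C[OF that] by (intro mult_right_mono) auto
    finally show ?thesis by (simp add: mult.assoc algebra_simps flip: exp_add)
  qed
  have int: "set_integrable lborel {0..} h"
  proof (rule set_integrable_bound)
    show "set_integrable lborel {0..} (\<lambda>u. C * exp (- (Re s - r) * u))"
      using exp_decay_set_integrable[of "Re s - r"] r by simp
    show "set_borel_measurable lborel {0..} h"
      unfolding set_borel_measurable_def h_def by measurable
    show "AE u in lborel. u \<in> {0..} \<longrightarrow> cmod (h u) \<le> norm (C * exp (- (Re s - r) * u))"
      using hb by (intro AE_I2) (fastforce intro: order_trans[OF _ abs_ge_self])
  qed
  then show "set_integrable lborel {0..} (\<lambda>u. of_real (A (exp u)) * exp (- (s * of_real u)))"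
    by (simp add: h_def[abs_def])
  define Q where "Q = s * (LINT u:{0..}|lborel. h u)"
  \<comment> \<open>Identifying every admissible limit with Q supplies the uniqueness that the
    definite description in \<open>mellin_stieltjes\<close> demands.\<close>
  have "L = Q" if L: "has_mellin_stieltjes A s L" for L
  proof -
    obtain I where I: "\<And>X. X \<ge> 1 \<Longrightarrow> has_stieltjes_integral (\<lambda>x. of_real x powr (- s)) A 1 X (I X)"
      and lim: "((\<lambda>X. of_real (A 1) + I X) \<longlongrightarrow> L) at_top"
      using L unfolding has_mellin_stieltjes_def by blast
    have Ieq: "of_real (A 1) + I X = h (ln X) + s * (LINT u:{0..ln X}|lborel. h u)" if "X \<ge> 1" for X
    proof -
      have "of_real X powr (- s) * of_real (A X) = h (ln X)"
        using that by (simp add: h_def powr_def Ln_of_real)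
      moreover have "integral {0..ln X} h = (LINT u:{0..ln X}|lborel. h u)"
        by (rule set_borel_integral_eq_integral(2)[symmetric])
           (rule set_integrable_subset[OF int], auto)
      moreover have "I X = of_real X powr (- s) * of_real (A X) - of_real (A 1) + s * integral {0..ln X} h"
        using has_stieltjes_integral_unique[OF I[OF that] has_stieltjes_integral_powr(2)[OF V z, where s = s and X = X]] r that
        by (simp add: h_def[abs_def])
      ultimately show ?thesis by simp
    qed
    have h0: "(h \<longlongrightarrow> 0) at_top"
    proof (rule Lim_null_comparison)
      show "\<forall>\<^sub>F u in at_top. cmod (h u) \<le> C * exp (- (Re s - r) * u)"
        using eventually_ge_at_top[of 0] by eventually_elim (rule hb)
      have "filterlim (\<lambda>u. (Re s - r) * u) at_top at_top"
        using r by (intro filterlim_tendsto_pos_mult_at_top[OF tendsto_const _ filterlim_ident]) auto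
      then have "((\<lambda>u. exp (- ((Re s - r) * u))) \<longlongrightarrow> 0) at_top"
        by (intro filterlim_compose[OF exp_at_bot]) (simp add: filterlim_uminus_at_bot)
      from tendsto_mult_right_zero[OF this, of C]
      show "((\<lambda>u. C * exp (- (Re s - r) * u)) \<longlongrightarrow> 0) at_top"
        by (simp only: mult_minus_left)
    qed
    have "((\<lambda>b. h b + s * (LINT u:{0..b}|lborel. h u)) \<longlongrightarrow> 0 + Q) at_top"
      unfolding Q_def
      by (intro tendsto_add h0 tendsto_mult tendsto_const tendsto_set_lebesgue_integral_at_top int) auto
    then have "((\<lambda>X. h (ln X) + s * (LINT u:{0..ln X}|lborel. h u)) \<longlongrightarrow> Q) at_top"
      using filterlim_compose[OF _ ln_at_top] by fastforce
    moreover have "\<forall>\<^sub>F X in at_top. h (ln X) + s * (LINT u:{0..ln X}|lborel. h u) = of_real (A 1) + I X"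
      using eventually_ge_at_top[of 1] by eventually_elim (simp add: Ieq)
    ultimately have "((\<lambda>X. of_real (A 1) + I X) \<longlongrightarrow> Q) at_top"
      by (rule Lim_transform_eventually)
    then show "L = Q" using lim tendsto_unique trivial_limit_at_top_linorder by blast
  qed
  then have "mellin_stieltjes A s = Q"
    unfolding mellin_stieltjes_def using ex by (metis (mono_tags, lifting) the_equality)
  then show "mellin_stieltjes A s
      = s * (LINT u:{0..}|lborel. of_real (A (exp u)) * exp (- (s * of_real u)))"
    by (simp add: Q_def h_def[abs_def])
qed

section \<open>Means against the Fejer kernel\<close>

text \<open>This is the square of sin(w/2)/(w/2), unnormalised, with its limit 1 at the
  origin.\<close>

definition fejer :: "real \<Rightarrow> real" where
  "fejer w = (if w = 0 then 1 else 2 * (1 - cos w) / w\<^sup>2)"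

lemma fejer_measurable [measurable]: "fejer \<in> borel_measurable borel"
  unfolding fejer_def[abs_def] by measurable

lemma fejer_nonneg: "fejer w \<ge> 0"
  by (simp add: fejer_def)

lemma fejer_le_1: "fejer w \<le> 1"
proof -
  have "1 - cos w = 2 * (sin (w / 2))\<^sup>2"
    using cos_double_sin[of "w / 2"] by simp
  also have "\<dots> \<le> 2 * (w / 2)\<^sup>2"
    using abs_le_square_iff[THEN iffD1, OF abs_sin_x_le_abs_x[of "w / 2"]] by (intro mult_left_mono) auto
  finally have "2 * (1 - cos w) \<le> w\<^sup>2" by (simp add: power2_eq_square)
  then show ?thesis by (cases "w = 0") (simp_all add: fejer_def pos_divide_le_eq)
qed

lemma fejer_le_inverse_square: "w \<noteq> 0 \<Longrightarrow> fejer w \<le> 4 / w\<^sup>2"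
  using divide_right_mono[of "2 * (1 - cos w)" 4 "w\<^sup>2"] cos_ge_minus_one[of w]
  by (simp add: fejer_def)

text \<open>Taylor expansion of order 4 gives cos w \<le> 1 - w^2/2 + w^4/24.\<close>

lemma fejer_ge: "fejer w \<ge> 1 - w\<^sup>2 / 12"
proof (cases "w = 0")
  case False
  obtain t where t: "cos w = (\<Sum>m<4. cos_coeff m * w ^ m) + (cos (t + 1/2 * real 4 * pi) / fact 4) * w ^ 4"
    using Maclaurin_cos_expansion[of w 4] by auto
  have "(\<Sum>m<4. cos_coeff m * w ^ m) = 1 - w\<^sup>2 / 2"
    by (simp add: cos_coeff_def numeral_eq_Suc) presburger
  then have "cos w = 1 - w\<^sup>2 / 2 + cos (t + 2 * pi) / 24 * w ^ 4"
    using t by (simp add: fact_numeral)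
  moreover have "cos (t + 2 * pi) / 24 * w ^ 4 \<le> 1 / 24 * w ^ 4"
    by (intro mult_right_mono divide_right_mono) auto
  ultimately have "w\<^sup>2 * (1 - w\<^sup>2 / 12) \<le> 2 * (1 - cos w)"
    by (simp add: algebra_simps power2_eq_square power4_eq_xxxx)
  then show ?thesis using False by (simp add: fejer_def field_simps)
qed (simp add: fejer_def)

text \<open>Majorant of the kernel on one side, used together with its reflection. Each side has
  mass 4/5, whence 8/5.\<close>

definition fejer_tail :: "real \<Rightarrow> real" where
  "fejer_tail w = indicator {5..} w * (4 / w\<^sup>2)"

lemma fejer_tail_integral: "integrable lborel fejer_tail" "(LINT w|lborel. fejer_tail w) = 4 / 5"
proof -
  have "((\<lambda>x::real. 1 / x ^ 2) has_integral 1 / (real (2 - 1) * 5 ^ (2 - 1))) {5..}"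
    by (rule has_integral_inverse_power_to_inf) auto
  then have I: "((\<lambda>x::real. 4 * (1 / x\<^sup>2)) has_integral 4 * (1 / 5)) {5..}"
    by (intro has_integral_mult_right) simp
  from has_integral_nonneg_lborel[OF _ _ _ I]
  have "set_integrable lborel {5..} (\<lambda>x::real. 4 * (1 / x\<^sup>2))"
    "(LINT x:{5..}|lborel. 4 * (1 / x\<^sup>2)) = 4 * (1 / 5 :: real)" by auto
  then show "integrable lborel fejer_tail" "(LINT w|lborel. fejer_tail w) = 4 / 5"
    by (simp_all add: set_integrable_def set_lebesgue_integral_def fejer_tail_def[abs_def])
qed

lemma fejer_tail_reflect:
  "integrable lborel (\<lambda>w. fejer_tail (- w))" "(LINT w|lborel. fejer_tail (- w)) = 4 / 5"
  using lborel_integrable_real_affine[OF fejer_tail_integral(1), of "-1" 0]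
    lborel_integral_real_affine[of "-1" fejer_tail 0] fejer_tail_integral(2) by auto

lemma fejer_tail_nonneg: "fejer_tail w \<ge> 0"
  by (simp add: fejer_tail_def)

lemma fejer_integrable: "integrable lborel fejer"
proof (rule Bochner_Integration.integrable_bound)
  show "integrable lborel (\<lambda>w. indicator {-5..5} w + fejer_tail w + fejer_tail (- w))"
    by (intro Bochner_Integration.integrable_add fejer_tail_integral fejer_tail_reflect)
       (simp add: emeasure_lborel_Icc_eq)
  have "norm (fejer w) \<le> norm (indicator {-5..5} w + fejer_tail w + fejer_tail (- w))" for w
  proof -
    have "fejer w \<le> indicator {-5..5} w + fejer_tail w + fejer_tail (- w)"
    proof (cases "\<bar>w\<bar> \<le> 5")
      case True
      then show ?thesis
        using fejer_le_1[of w] fejer_tail_nonneg[of w] fejer_tail_nonneg[of "- w"]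
        by (simp add: indicator_def abs_le_iff)
    next
      case False
      then have "w \<noteq> 0" "w \<ge> 5 \<or> - w \<ge> 5" by auto
      have "(0::real) \<le> indicator {-5..5} w" by simp
      moreover have "4 / w\<^sup>2 \<le> fejer_tail w + fejer_tail (- w)" using \<open>w \<ge> 5 \<or> - w \<ge> 5\<close> by (auto simp: fejer_tail_def)
      ultimately show ?thesis
        using fejer_le_inverse_square[OF \<open>w \<noteq> 0\<close>] by linarith
    qed
    then show ?thesis using fejer_nonneg[of w] by simp
  qed
  then show "AE w in lborel. norm (fejer w)
      \<le> norm (indicator {-5..5} w + fejer_tail w + fejer_tail (- w))"
    by (rule AE_I2)
qed simp

text \<open>The numbers \<open>9/2\<close> and \<open>8/5\<close> bound the mass of the kernel inside \<open>[-5,5]\<close> from below and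
  outside from above; all that matters later is that \<open>9/2 \<cdot> 1/2 > 8/5\<close>.\<close>

lemma fejer_mean_ge:
  assumes [measurable]: "\<beta> \<in> borel_measurable borel"
    and bdd: "\<And>w. \<bar>\<beta> w\<bar> \<le> B" and low: "\<And>w. \<beta> w \<ge> - S"
    and win: "\<And>w. \<bar>w\<bar> \<le> 5 \<Longrightarrow> \<beta> w \<ge> L" and L: "L \<ge> 0" and S: "S \<ge> 0"
  shows "9 / 2 * L - 8 / 5 * S \<le> (LINT w|lborel. \<beta> w * fejer w)"
proof -
  \<comment> \<open>The Taylor minorant is negative beyond the square root of 12, so it is cut at 3
    and not at 5; its mass is 6 - 3/2 = 9/2.\<close>
  define p where "p w = indicator {-3..3} w * (1 - w\<^sup>2 / 12)" for w :: real
  have "((\<lambda>w::real. 1 - w\<^sup>2 / 12) has_integral ((3 - 3 ^ 3 / 36) - (- 3 - (- 3) ^ 3 / 36))) {-3..3}"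
    by (rule fundamental_theorem_of_calculus)
       (auto intro!: derivative_eq_intros simp flip: has_real_derivative_iff_has_vector_derivative)
  then have I: "((\<lambda>w::real. 1 - w\<^sup>2 / 12) has_integral 9 / 2) {-3..3}" by simp
  have nn: "1 - w\<^sup>2 / 12 \<ge> 0" if "w \<in> {-3..3}" for w :: real
  proof -
    have "w\<^sup>2 \<le> 3\<^sup>2" using that by (intro power2_le_iff_abs_le[THEN iffD2]) auto
    then show ?thesis by simp
  qed
  have p: "integrable lborel p" "(LINT w|lborel. p w) = 9 / 2"
    using has_integral_nonneg_lborel[OF _ _ nn I]
    by (simp_all add: set_integrable_def set_lebesgue_integral_def p_def[abs_def])
  have "9 / 2 * L - 8 / 5 * S = (LINT w|lborel. L * p w - S * (fejer_tail w + fejer_tail (- w)))"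
    using p(1) fejer_tail_integral(1) fejer_tail_reflect(1)
    by (simp add: p(2) fejer_tail_integral(2) fejer_tail_reflect(2))
  also have "\<dots> \<le> (LINT w|lborel. \<beta> w * fejer w)"
  proof (rule integral_mono)
    show "integrable lborel (\<lambda>w. L * p w - S * (fejer_tail w + fejer_tail (- w)))"
      using p fejer_tail_integral fejer_tail_reflect by simp
    show "integrable lborel (\<lambda>w. \<beta> w * fejer w)"
    proof (rule Bochner_Integration.integrable_bound)
      show "integrable lborel (\<lambda>w. B * fejer w)" using fejer_integrable by simp
      have "norm (\<beta> w * fejer w) \<le> norm (B * fejer w)" for w
        using bdd[of w] by (auto simp: abs_mult intro!: mult_right_mono)
      then show "AE w in lborel. norm (\<beta> w * fejer w) \<le> norm (B * fejer w)" by simp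
    qed measurable
    fix w
    \<comment> \<open>Inside the window the tails vanish and \<beta> \<ge> L; outside, p vanishes
      and \<beta> \<ge> -S. The split is strict because \<open>fejer_tail\<close> is already
      positive at 5.\<close>
    show "L * p w - S * (fejer_tail w + fejer_tail (- w)) \<le> \<beta> w * fejer w"
    proof (cases "\<bar>w\<bar> < 5")
      case True
      then have t: "fejer_tail w = 0" "fejer_tail (- w) = 0" by (auto simp: fejer_tail_def)
      have "L * p w \<le> L * fejer w"
        using fejer_ge[of w] fejer_nonneg[of w] L by (intro mult_left_mono) (auto simp: p_def indicator_def)
      also have "\<dots> \<le> \<beta> w * fejer w"
        using win[of w] True fejer_nonneg[of w] by (intro mult_right_mono) auto
      finally show ?thesis by (simp add: t)
    next
      case False
      then have p0: "p w = 0" by (auto simp: p_def indicator_def)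
      have "fejer w \<le> fejer_tail w + fejer_tail (- w)"
        using fejer_le_inverse_square[of w] False by (auto simp: fejer_tail_def indicator_def)
      then have "S * fejer w \<le> S * (fejer_tail w + fejer_tail (- w))" using S by (rule mult_left_mono)
      moreover have "- S * fejer w \<le> \<beta> w * fejer w"
        using low[of w] fejer_nonneg[of w] by (intro mult_right_mono) auto
      ultimately show ?thesis by (simp add: p0)
    qed
  qed
  finally show ?thesis .
qed

text \<open>The triangle is chosen for the sign of its transform: a sharp cutoff at T would produce
  sin(Tw)/w, and one-sided bounds do not survive a kernel of varying sign.\<close>

lemma fejer_eq_cosine_integral:
  assumes T: "T > 0"
  shows "((\<lambda>t. (1 - t / T) * cos (t * w)) has_integral (T * fejer (T * w) / 2)) {0..T}"
proof (cases "w = 0")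
  case True
  have "((\<lambda>t. 1 - t / T) has_integral ((T - T\<^sup>2 / (2 * T)) - (0 - 0\<^sup>2 / (2 * T)))) {0..T}"
    by (rule fundamental_theorem_of_calculus)
       (use T in \<open>auto intro!: derivative_eq_intros simp: field_simps simp flip: has_real_derivative_iff_has_vector_derivative\<close>)
  then show ?thesis using True T by (simp add: fejer_def power2_eq_square)
next
  case False
  \<comment> \<open>The antiderivative found by parts; its divisions by w are the reason for
    treating w = 0 apart.\<close>
  define G where "G t = (1 - t / T) * (sin (t * w) / w) - cos (t * w) / (T * w\<^sup>2)" for t
  have "(G has_real_derivative (1 - t / T) * cos (t * w)) (at t within {0..T})" for t
  proof -
    have "(G has_real_derivative (- 1 / T) * (sin (t * w) / w) + (cos (t * w) * w / w) * (1 - t / T)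
        - (- (sin (t * w) * w)) / (T * w\<^sup>2)) (at t within {0..T})"
      unfolding G_def using T False by (auto intro!: derivative_eq_intros simp: diff_divide_distrib)
    moreover have "sin (t * w) * w / (T * w\<^sup>2) = (1 / T) * (sin (t * w) / w)"
      using False by (simp add: power2_eq_square)
    ultimately show ?thesis using False by (simp add: mult.commute)
  qed
  then have "((\<lambda>t. (1 - t / T) * cos (t * w)) has_integral (G T - G 0)) {0..T}"
    using T by (intro fundamental_theorem_of_calculus)
       (auto simp flip: has_real_derivative_iff_has_vector_derivative)
  moreover have "G T - G 0 = T * fejer (T * w) / 2"
    using T False by (simp add: G_def fejer_def power2_eq_square right_diff_distrib diff_divide_distrib mult.left_commute)
  ultimately show ?thesis by simp
qed

section \<open>Fourier transforms and the smoothed Tauberian inequality\<close>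

definition fourier :: "(real \<Rightarrow> real) \<Rightarrow> real \<Rightarrow> complex" where
  "fourier b t = (LINT u|lborel. of_real (b u) * cis (- (t * u)))"

lemma fourier_integrand_integrable:
  assumes "integrable lborel b"
  shows "integrable lborel (\<lambda>u. of_real (b u) * cis (- (t * u)))"
proof (rule Bochner_Integration.integrable_bound[OF assms])
  have [measurable]: "b \<in> borel_measurable borel" using assms by auto
  have "(\<lambda>u. cis (- (t * u))) \<in> borel_measurable borel"
    by (intro borel_measurable_continuous_onI continuous_intros)
  then show "(\<lambda>u. of_real (b u) * cis (- (t * u))) \<in> borel_measurable lborel" by measurable
qed (simp add: norm_mult)

text \<open>Continuity makes the modulus of the transform integrable on [0,T]. A nonintegrable
  function has Lebesgue integral 0 by convention and could not serve as an upper bound.\<close>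

lemma fourier_continuous:
  assumes "integrable lborel b"
  shows "continuous_on UNIV (fourier b)"
proof -
  have "isCont (fourier b) t" for t
    unfolding continuous_at_sequentially o_def
  proof (intro allI impI)
    fix x assume x: "x \<longlonglongrightarrow> t"
    show "(\<lambda>n. fourier b (x n)) \<longlonglongrightarrow> fourier b t"
      unfolding fourier_def
    proof (rule integral_dominated_convergence[where w = "\<lambda>u. \<bar>b u\<bar>"])
      show "integrable lborel (\<lambda>u. \<bar>b u\<bar>)" using assms by auto
      show "AE u in lborel. (\<lambda>n. of_real (b u) * cis (- (x n * u))) \<longlonglongrightarrow> of_real (b u) * cis (- (t * u))"
        unfolding cis_conv_exp by (intro AE_I2 tendsto_intros x)
    qed (use fourier_integrand_integrable[OF assms] in \<open>auto simp: norm_mult\<close>)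
  qed
  then show ?thesis by (simp add: continuous_at_imp_continuous_on)
qed

text \<open>Parseval: with the kernel written as a cosine integral, exchanging the integrals leaves
  the real part of a rotated Fourier transform inside, and the weight 1 - t/T is at most 1. The
  factor 2 arises because only the nonnegative half of the symmetric triangle is integrated.\<close>

lemma fejer_convolution_le:
  assumes b: "integrable lborel b" and T: "T > 0"
  shows "(LINT w|lborel. b (c - w / T) * fejer w) \<le> 2 * (LINT t:{0..T}|lborel. cmod (fourier b t))"
proof -
  have bm[measurable]: "b \<in> borel_measurable borel" using b by auto
  \<comment> \<open>With the indicator inside, Fubini applies on the whole plane; the majorant is
    the indicator of [0,T] in t times |b u|.\<close>
  define f where "f t u = indicator {0..T} t * ((1 - t / T) * (b u * cos (t * (c - u))))" for t u
  have tr: "\<bar>indicator {0..T} t * (1 - t / T)\<bar> \<le> indicator {0..T} t" for t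
    using T by (auto simp: indicator_def field_simps abs_le_iff)
  have fb: "norm (f t u) \<le> indicator {0..T} t * \<bar>b u\<bar>" for t u
  proof -
    have "norm (f t u) = \<bar>indicator {0..T} t * (1 - t / T)\<bar> * (\<bar>b u\<bar> * \<bar>cos (t * (c - u))\<bar>)"
      by (simp add: f_def abs_mult)
    also have "\<dots> \<le> indicator {0..T} t * (\<bar>b u\<bar> * 1)"
      using tr[of t] by (intro mult_mono) auto
    finally show ?thesis by simp
  qed
  have fm[measurable]: "(\<lambda>(t, u). f t u) \<in> borel_measurable (lborel \<Otimes>\<^sub>M lborel)"
    unfolding f_def by measurable
  have fint: "integrable lborel (f t)" for t
    by (rule Bochner_Integration.integrable_bound[of _ "\<lambda>u. indicator {0..T} t * \<bar>b u\<bar>"])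
       (use b fb in \<open>auto simp: f_def\<close>)
  have ind: "integrable lborel (indicator {0..T} :: real \<Rightarrow> real)"
    by (simp add: emeasure_lborel_Icc_eq)
  have F: "integrable (lborel \<Otimes>\<^sub>M lborel) (case_prod f)"
  proof (rule lborel_pair.Fubini_integrable)
    show "integrable lborel (\<lambda>t. LINT u|lborel. norm (case_prod f (t, u)))"
    proof (rule Bochner_Integration.integrable_bound[of _ "\<lambda>t. indicator {0..T} t * (LINT u|lborel. \<bar>b u\<bar>)"])
      show "integrable lborel (\<lambda>t. indicator {0..T} t * (LINT u|lborel. \<bar>b u\<bar>))"
        using ind by simp
      have "(LINT u|lborel. norm (f t u)) \<le> (LINT u|lborel. indicator {0..T} t * \<bar>b u\<bar>)" for t
        by (rule integral_mono) (use b fb fint in auto)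
      then show "AE t in lborel. norm (LINT u|lborel. norm (case_prod f (t, u)))
          \<le> norm (indicator {0..T} t * (LINT u|lborel. \<bar>b u\<bar>))"
        by (intro AE_I2) (fastforce intro: order_trans[OF _ abs_ge_self])
    qed measurable
  qed (use fint in auto)
  have "(LINT w|lborel. b (c - w / T) * fejer w)
      = T * (LINT u|lborel. b u * fejer (T * (c - u)))"
    using lborel_integral_real_affine[of "- 1 / T" "\<lambda>u. b u * fejer (T * (c - u))" c] T by simp
  also have "\<dots> = (LINT u|lborel. 2 * (LINT t|lborel. f t u))"
  proof (subst integral_mult_right_zero[symmetric], rule Bochner_Integration.integral_cong)
    fix u
    have I: "((\<lambda>t. (1 - t / T) * cos (t * (c - u))) has_integral (T * fejer (T * (c - u)) / 2)) {0..T}"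
      by (rule fejer_eq_cosine_integral[OF T])
    have si: "set_integrable lborel {0..T} (\<lambda>t. (1 - t / T) * cos (t * (c - u)))"
      by (rule borel_integrable_atLeastAtMost') (intro continuous_intros, use T in auto)
    have "(LINT t|lborel. f t u) = b u * (LINT t:{0..T}|lborel. (1 - t / T) * cos (t * (c - u)))"
      unfolding set_lebesgue_integral_def f_def
      by (subst integral_mult_right_zero[symmetric], rule Bochner_Integration.integral_cong) auto
    also have "(LINT t:{0..T}|lborel. (1 - t / T) * cos (t * (c - u))) = T * fejer (T * (c - u)) / 2"
      using set_borel_integral_eq_integral(2)[OF si] I by (simp add: integral_unique)
    finally show "T * (b u * fejer (T * (c - u))) = 2 * (LINT t|lborel. f t u)"
      by (simp add: mult_ac)
  qed simp
  also have "\<dots> = 2 * (LINT t|lborel. LINT u|lborel. f t u)"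
    using lborel_pair.Fubini_integral[OF F] by simp
  also have "(LINT t|lborel. LINT u|lborel. f t u) \<le> (LINT t:{0..T}|lborel. cmod (fourier b t))"
    unfolding set_lebesgue_integral_def
  proof (rule integral_mono)
    show "integrable lborel (\<lambda>t. LINT u|lborel. f t u)"
      using lborel_pair.integrable_fst'[OF F] by simp
    show "integrable lborel (\<lambda>t. indicator {0..T} t *\<^sub>R cmod (fourier b t))"
      using borel_integrable_atLeastAtMost'[of 0 T "\<lambda>t. cmod (fourier b t)"]
        continuous_on_norm[OF continuous_on_subset[OF fourier_continuous[OF b]], of "{0..T}"]
      by (simp add: set_integrable_def)
    fix t
    have re: "(LINT u|lborel. b u * cos (t * (c - u))) = Re (cis (t * c) * fourier b t)"
    proof -
      have "cis (t * c) * fourier b t = (LINT u|lborel. cis (t * c) * (of_real (b u) * cis (- (t * u))))"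
        unfolding fourier_def by simp
      also have "Re \<dots> = (LINT u|lborel. Re (cis (t * c) * (of_real (b u) * cis (- (t * u)))))"
        by (rule integral_Re[symmetric]) (use fourier_integrand_integrable[OF b] in simp)
      also have "\<dots> = (LINT u|lborel. b u * cos (t * (c - u)))"
        by (intro Bochner_Integration.integral_cong) (auto simp: right_diff_distrib cos_diff algebra_simps)
      finally show ?thesis by simp
    qed
    have "\<bar>Re (cis (t * c) * fourier b t)\<bar> \<le> cmod (fourier b t)"
      using abs_Re_le_cmod[of "cis (t * c) * fourier b t"] by (simp add: norm_mult del: times_complex.sel)
    then have "\<bar>indicator {0..T} t * (1 - t / T)\<bar> * \<bar>Re (cis (t * c) * fourier b t)\<bar>
        \<le> indicator {0..T} t * cmod (fourier b t)"
      using tr[of t] by (intro mult_mono) auto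
    then have "indicator {0..T} t * (1 - t / T) * Re (cis (t * c) * fourier b t)
        \<le> indicator {0..T} t * cmod (fourier b t)"
      using abs_ge_self order_trans unfolding abs_mult[symmetric] by blast
    moreover have "(LINT u|lborel. f t u)
        = indicator {0..T} t * (1 - t / T) * (LINT u|lborel. b u * cos (t * (c - u)))"
      unfolding f_def by (simp add: mult.assoc)
    ultimately show "(LINT u|lborel. f t u) \<le> indicator {0..T} t *\<^sub>R cmod (fourier b t)"
      by (simp add: re del: times_complex.sel)
  qed
  finally show ?thesis by simp
qed

text \<open>In the variable w = T (c - u) the window |w| \<le> 5 has length 10/T in u, the window
  length of the theorem. \<open>B\<close> secures integrability; the estimate itself is carried by
  \<open>S\<close> and \<open>L\<close>.\<close>

lemma fejer_tauberian_bound: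
  assumes b: "integrable lborel b" and bdd: "\<And>u. \<bar>b u\<bar> \<le> B" and T: "T > 0"
    and low: "\<And>u. b u \<ge> - S" and S: "S \<ge> 0" and L: "L \<ge> 0"
    and win: "\<And>u. \<bar>u - c\<bar> \<le> 5 / T \<Longrightarrow> b u \<ge> L"
  shows "9 / 2 * L \<le> 2 * (LINT t:{0..T}|lborel. cmod (fourier b t)) + 8 / 5 * S"
proof -
  have [measurable]: "b \<in> borel_measurable borel" using b by auto
  have "9 / 2 * L - 8 / 5 * S \<le> (LINT w|lborel. b (c - w / T) * fejer w)"
  proof (rule fejer_mean_ge[OF _ _ _ _ L S])
    fix w :: real assume "\<bar>w\<bar> \<le> 5"
    then show "b (c - w / T) \<ge> L"
      using T by (intro win) (simp add: abs_divide divide_right_mono)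
  qed (use bdd low in auto)
  then show ?thesis using fejer_convolution_le[OF b T, of c] by simp
qed

section \<open>The comparison integral\<close>

text \<open>The claimed order of A(x)/x in terms of y = ln x.\<close>

definition growth_fun :: "real \<Rightarrow> real \<Rightarrow> real" where
  "growth_fun m y = (if m = 1 then ln y else y powr pos_part (m - 1))"

text \<open>\<open>Some T\<close> occurs only for m = 0. At m = 1 the quotient 1 / \<bar>m - 1\<bar>
  is 0 by the convention for division by zero, so the constant is 4 there.\<close>

definition Z_const :: "real \<Rightarrow> real option \<Rightarrow> real" where
  "Z_const m t = (case t of None \<Rightarrow> 3 + 1 / \<bar>m - 1\<bar> + 1 / m | Some T \<Rightarrow> T)"

text \<open>This lets bounded terms be absorbed into the order of growth. For m = 1 it needs ln y
  \<ge> 1, which is why that case starts at x = e^e.\<close>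

lemma growth_fun_ge_1:
  assumes "y \<ge> 1" "m = 1 \<Longrightarrow> y \<ge> exp 1"
  shows "growth_fun m y \<ge> 1"
  using assms ln_ge_iff[of y 1] by (auto simp: growth_fun_def pos_part_def ge_one_powr_ge_zero)

lemma powr_integral_1:
  fixes \<sigma> m :: real
  assumes "0 < \<sigma>" "\<sigma> \<le> 1" "m \<noteq> 1"
  shows "((\<lambda>t. t powr (- m)) has_integral (1 - \<sigma> powr (1 - m)) / (1 - m)) {\<sigma>..1}"
proof -
  have "((\<lambda>t. t powr (- m)) has_integral (1 powr (1 - m) / (1 - m) - \<sigma> powr (1 - m) / (1 - m))) {\<sigma>..1}"
    using assms
    by (intro fundamental_theorem_of_calculus)
       (auto intro!: derivative_eq_intros simp flip: has_real_derivative_iff_has_vector_derivative)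
  then show ?thesis by (simp add: diff_divide_distrib)
qed

lemma powr_integral_ln:
  fixes \<sigma> :: real
  assumes "0 < \<sigma>" "\<sigma> \<le> 1"
  shows "((\<lambda>t. t powr (- 1)) has_integral (- ln \<sigma>)) {\<sigma>..1}"
proof -
  have "((\<lambda>t. t powr (- 1)) has_integral (ln 1 - ln \<sigma>)) {\<sigma>..1}"
    using assms
    by (intro fundamental_theorem_of_calculus)
       (auto intro!: derivative_eq_intros simp: powr_minus field_simps
          simp flip: has_real_derivative_iff_has_vector_derivative)
  then show ?thesis by simp
qed

text \<open>The ranges t \<le> \<sigma>, \<sigma> \<le> t \<le> 1 and t \<ge> 1 contribute at most
  \<sigma>^(1-m), \<open>J\<close> and 1/m. The middle one decides the order and becomes logarithmic
  at m = 1, where \<sigma> \<le> 1/e makes -ln \<sigma> dominate the constant terms.\<close>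

lemma Z_int_le:
  assumes m: "m > 0" and \<sigma>: "0 < \<sigma>" "\<sigma> < 1" "m = 1 \<Longrightarrow> \<sigma> \<le> exp (- 1)"
  shows "Z_int m \<sigma> \<infinity> \<le> (3 + 1 / \<bar>m - 1\<bar> + 1 / m) * growth_fun m (1 / \<sigma>)"
proof -
  define J where "J = (if m = 1 then - ln \<sigma> else (1 - \<sigma> powr (1 - m)) / (1 - m))"
  have J: "((\<lambda>t. t powr (- m)) has_integral J) {\<sigma>..1}"
    using powr_integral_1[of \<sigma> m] powr_integral_ln[of \<sigma>] \<sigma> by (auto simp: J_def)
  have I: "((\<lambda>t. t powr (- m - 1)) has_integral - (1 powr (- m - 1 + 1)) / (- m - 1 + 1)) {1..}"
    using m by (intro has_integral_powr_to_inf) auto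
  \<comment> \<open>The two moduli are at least max(\<sigma>, t) and max(1, t); each range uses the
    larger entry.\<close>
  define g where "g t = indicator {0..\<sigma>} t * \<sigma> powr (- m) + (indicator {\<sigma>..1} t * t powr (- m)
      + indicator {1..} t * t powr (- m - 1))" for t :: real
  have g1: "integrable lborel (\<lambda>t. indicator {0..\<sigma>} t * \<sigma> powr (- m))"
    "(LINT t|lborel. indicator {0..\<sigma>} t * \<sigma> powr (- m)) = \<sigma> * \<sigma> powr (- m)"
    using \<sigma> by (simp_all add: emeasure_lborel_Icc_eq)
  have g2: "integrable lborel (\<lambda>t. indicator {\<sigma>..1} t * t powr (- m))"
    "(LINT t|lborel. indicator {\<sigma>..1} t * t powr (- m)) = J"
    using has_integral_nonneg_lborel[OF _ _ _ J]
    by (simp_all add: set_integrable_def set_lebesgue_integral_def)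
  have g3: "integrable lborel (\<lambda>t. indicator {1..} t * t powr (- m - 1))"
    "(LINT t|lborel. indicator {1..} t * t powr (- m - 1)) = 1 / m"
    using has_integral_nonneg_lborel[OF _ _ _ I]
    by (simp_all add: set_integrable_def set_lebesgue_integral_def)
  have "Z_int m \<sigma> \<infinity> = (LINT t|lborel. indicator {0<..} t *
      (1 / (cmod (Complex \<sigma> t) powr m * cmod (Complex (1 + \<sigma>) t))))"
  proof -
    have "einterval 0 \<infinity> = {0<..}" by (auto simp: einterval_def)
    then show ?thesis
      by (simp add: Z_int_def interval_lebesgue_integral_def set_lebesgue_integral_def)
  qed
  also have "\<dots> \<le> (LINT t|lborel. g t)"
  proof (rule integral_mono')
    show "integrable lborel g"
      unfolding g_def by (intro Bochner_Integration.integrable_add g1 g2 g3)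
    fix t :: real
    show "0 \<le> g t" by (auto simp: g_def)
    show "indicator {0<..} t * (1 / (cmod (Complex \<sigma> t) powr m * cmod (Complex (1 + \<sigma>) t))) \<le> g t"
    proof (cases "t > 0")
      case True
      define p q where "p = cmod (Complex \<sigma> t)" and "q = cmod (Complex (1 + \<sigma>) t)"
      have p: "\<sigma> \<le> p" "t \<le> p"
        using abs_Re_le_cmod[of "Complex \<sigma> t"] abs_Im_le_cmod[of "Complex \<sigma> t"] by (auto simp: p_def)
      have q: "1 \<le> q" "t \<le> q"
        using abs_Re_le_cmod[of "Complex (1 + \<sigma>) t"] abs_Im_le_cmod[of "Complex (1 + \<sigma>) t"] \<sigma>
        by (auto simp: q_def)
      have gen: "1 / (p powr m * q) \<le> a powr (- m) * (1 / r)"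
        if "0 < a" "a \<le> p" "0 < r" "r \<le> q" for a r
      proof -
        have "a powr m * r \<le> p powr m * q"
          using that m by (intro mult_mono powr_mono2) auto
        then have "1 / (p powr m * q) \<le> 1 / (a powr m * r)"
          using that by (intro divide_left_mono mult_pos_pos) auto
        then show ?thesis using that by (simp add: powr_minus field_simps)
      qed
      consider "t \<le> \<sigma>" | "\<sigma> < t" "t \<le> 1" | "1 < t" by linarith
      then have "1 / (p powr m * q) \<le> g t"
      proof cases
        case 1
        have "1 / (p powr m * q) \<le> \<sigma> powr (- m)" using gen[of \<sigma> 1] p q \<sigma> by simp
        then show ?thesis using 1 True by (auto simp: g_def indicator_def intro: order_trans)
      next
        case 2
        have "1 / (p powr m * q) \<le> t powr (- m)" using gen[of t 1] p q True by simp
        then show ?thesis using 2 True by (auto simp: g_def indicator_def intro: order_trans)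
      next
        case 3
        have "1 / (p powr m * q) \<le> t powr (- m) * (1 / t)" using gen[of t t] p q True by simp
        also have "\<dots> = t powr (- m - 1)" using True by (simp add: powr_diff)
        finally show ?thesis using 3 \<sigma> by (simp add: g_def)
      qed
      then show ?thesis using True by (simp add: p_def q_def)
    qed (auto simp: g_def)
  qed
  also have "(LINT t|lborel. g t) = \<sigma> * \<sigma> powr (- m) + (J + 1 / m)"
    unfolding g_def using g1(1) g2(1) g3(1)
    by (simp add: g1(2)[simplified] g2(2)[simplified] g3(2)[simplified])
  also have "\<sigma> * \<sigma> powr (- m) = \<sigma> powr (1 - m)"
    using \<sigma> by (simp add: powr_diff powr_minus field_simps)
  also have "\<sigma> powr (1 - m) + (J + 1 / m) \<le> (3 + 1 / \<bar>m - 1\<bar> + 1 / m) * growth_fun m (1 / \<sigma>)"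
  proof (cases "m = 1")
    case True
    have "1 \<le> - ln \<sigma>"
      using \<sigma> True ln_le_cancel_iff[of \<sigma> "exp (- 1)"] by simp
    then show ?thesis using True \<sigma> by (simp add: growth_fun_def J_def ln_div)
  next
    case False
    define E where "E = growth_fun m (1 / \<sigma>)"
    have E1: "1 \<le> E" unfolding E_def using \<sigma> False by (intro growth_fun_ge_1) auto
    have a: "\<sigma> powr (1 - m) \<le> E"
    proof (cases "m > 1")
      case True
      then have "E = \<sigma> powr (1 - m)"
        using False \<sigma> powr_minus_divide[of \<sigma> "m - 1"]
        by (simp add: E_def growth_fun_def pos_part_def powr_divide)
      then show ?thesis by simp
    next
      case False
      then have "\<sigma> powr (1 - m) \<le> 1" using \<sigma> by (intro powr_le1) auto
      then show ?thesis using E1 by simp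
    qed
    have b: "J \<le> (1 / \<bar>m - 1\<bar>) * E"
    proof (cases "m > 1")
      case True
      then have "J = (\<sigma> powr (1 - m) - 1) / (m - 1)"
        using False by (simp add: J_def field_simps)
      also have "\<dots> \<le> E / (m - 1)" using a True by (intro divide_right_mono) auto
      finally show ?thesis using True by simp
    next
      case m1: False
      then have "J \<le> 1 / (1 - m)"
        using False by (simp add: J_def divide_right_mono)
      also have "\<dots> \<le> E / (1 - m)" using E1 m1 by (intro divide_right_mono) auto
      finally show ?thesis using m1 by simp
    qed
    have c: "1 / m \<le> (1 / m) * E" using E1 m mult_left_mono[of 1 E "1 / m"] by simp
    show ?thesis
      using a b c E1 unfolding E_def[symmetric] distrib_right by linarith
  qed
  finally show ?thesis .
qed

text \<open>For m = 0 the integrand decays only like 1/t, so the range must stay finite; its length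
  T becomes the constant.\<close>

lemma Z_int_0_le:
  assumes "0 < \<sigma>" "T > 0"
  shows "Z_int 0 \<sigma> (ereal T) \<le> T"
proof -
  have "Z_int 0 \<sigma> (ereal T)
      = (LINT t:{0..T}|lborel. 1 / (cmod (Complex \<sigma> t) powr 0 * cmod (Complex (1 + \<sigma>) t)))"
    using assms interval_integral_Icc[of 0 T] by (simp add: Z_int_def zero_ereal_def)
  also have "\<dots> \<le> (LINT t|lborel. indicator {0..T} t)"
    unfolding set_lebesgue_integral_def
  proof (rule integral_mono')
    fix t
    have q: "1 \<le> cmod (Complex (1 + \<sigma>) t)"
      using abs_Re_le_cmod[of "Complex (1 + \<sigma>) t"] assms by auto
    have "1 / (cmod (Complex \<sigma> t) powr 0 * cmod (Complex (1 + \<sigma>) t)) \<le> 1"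
      using q assms by (simp add: complex_eq_iff divide_le_eq_1)
    then show "indicator {0..T} t *\<^sub>R (1 / (cmod (Complex \<sigma> t) powr 0 * cmod (Complex (1 + \<sigma>) t)))
        \<le> indicator {0..T} t"
      by (cases "t \<in> {0..T}") (simp_all only: indicator_simps scaleR_one scaleR_zero_left order_refl simp_thms)
  qed (use assms in \<open>auto simp: emeasure_lborel_Icc_eq\<close>)
  also have "\<dots> = T" using assms by simp
  finally show ?thesis .
qed

lemma Z_bound:
  assumes m: "m \<ge> 0" and T: "T > 0" and \<sigma>: "0 < \<sigma>" "\<sigma> < 1" "m = 1 \<Longrightarrow> \<sigma> \<le> exp (- 1)"
  shows "(if m > 0 then Z_int m \<sigma> \<infinity> else Z_int 0 \<sigma> (ereal T))
      \<le> Z_const m (T_dep m T) * growth_fun m (1 / \<sigma>)"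
proof (cases "m > 0")
  case True
  then show ?thesis using Z_int_le[OF True \<sigma>] by (simp add: Z_const_def T_dep_def)
next
  case False
  then have "growth_fun m (1 / \<sigma>) = 1" "m = 0" using m \<sigma> by (auto simp: growth_fun_def pos_part_def)
  then show ?thesis using Z_int_0_le[OF \<sigma>(1) T] by (simp add: Z_const_def T_dep_def)
qed

section \<open>One-sided growth conditions\<close>

text \<open>With v = u/y, the inequality v \<le> (1+q) e^(v/(1+q)) is raised to the power q. The
  sharp factor would be (q/e)^q; using 1 + q keeps q = 0 in the same argument.\<close>

lemma powr_mult_exp_le:
  fixes q :: real
  assumes q: "q \<ge> 0" and y: "y > 0" and u: "u \<ge> 0"
  shows "u powr q * exp (- (u / y)) \<le> (1 + q) powr q * y powr q"
proof -
  define v where "v = u / y"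
  have v: "v \<ge> 0" "u = v * y" using y u by (auto simp: v_def)
  have "v / (1 + q) \<le> exp (v / (1 + q))"
    using exp_ge_add_one_self[of "v / (1 + q)"] by linarith
  then have "v \<le> (1 + q) * exp (v / (1 + q))" using q by (simp add: field_simps)
  then have "v powr q \<le> ((1 + q) * exp (v / (1 + q))) powr q" using v q by (intro powr_mono2) auto
  also have "\<dots> = (1 + q) powr q * exp (v * (q / (1 + q)))"
    using q by (simp add: powr_mult exp_powr_real)
  also have "\<dots> \<le> (1 + q) powr q * exp v"
    using v q mult_left_mono[of "q / (1 + q)" 1 v] by (intro mult_left_mono) auto
  finally have "v powr q * exp (- v) \<le> (1 + q) powr q * exp v * exp (- v)"
    by (intro mult_right_mono) auto
  then have "v powr q * exp (- v) \<le> (1 + q) powr q" by (simp add: mult.assoc flip: exp_add)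
  then have "(v powr q * exp (- v)) * y powr q \<le> (1 + q) powr q * y powr q"
    by (intro mult_right_mono) auto
  moreover have "u powr q = v powr q * y powr q" using v y by (simp add: powr_mult)
  ultimately show ?thesis by (simp add: v_def mult_ac)
qed

text \<open>Origin of the term (m-2)_+ / ln 2 in c: with r = q / ln 2 the hypothesis says u/y \<ge>
  r/(1+r), and (1 + 1/r)^q \<le> e^(q/r) = 2.\<close>

lemma powr_quotient_ge_half:
  fixes q :: real
  assumes q: "q \<ge> 0" and y: "0 < u" "u \<le> y" and d: "(y - u) * (1 + q / ln 2) \<le> y"
  shows "1 / 2 \<le> (u / y) powr q"
proof (cases "q = 0")
  case True
  then show ?thesis using y by simp
next
  case False
  define r where "r = q / ln 2"
  have r: "r > 0" using q False by (simp add: r_def)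
  have "(y - u) * (1 + r) \<le> y" using d by (simp add: r_def)
  then have "y * r \<le> u * (1 + r)" by (simp add: algebra_simps)
  then have le: "r / (1 + r) \<le> u / y" using r y by (simp add: field_simps)
  have "(1 + r) / r = 1 + 1 / r" using r by (simp add: field_simps)
  then have "ln ((1 + r) / r) \<le> 1 / r" using ln_add_one_self_le_self[of "1 / r"] r by simp
  then have "q * ln ((1 + r) / r) \<le> q * (1 / r)" using q by (intro mult_left_mono) auto
  also have "\<dots> = ln 2" using False by (simp add: r_def)
  finally have "q * (ln (1 + r) - ln r) \<le> ln 2" using r by (simp add: ln_div)
  then have "- ln 2 \<le> q * ln (r / (1 + r))" using r by (simp add: ln_div algebra_simps)
  then have "exp (- ln 2) \<le> exp (q * ln (r / (1 + r)))" by simp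
  then have "1 / 2 \<le> (r / (1 + r)) powr q" using r by (simp add: powr_def exp_minus inverse_eq_divide)
  also have "\<dots> \<le> (u / y) powr q" using le q r by (intro powr_mono2) auto
  finally show ?thesis .
qed

text \<open>The pair x = y = a contributes 0 to the infimum. A finite \<open>nu_bar\<close> is
  therefore a nonnegative real, which \<open>real_of_ereal\<close> returns faithfully.\<close>

lemma nu_bar_nonneg:
  assumes "a \<ge> 0" "\<mu> \<ge> 1"
  shows "nu_bar a f \<mu> \<ge> 0"
proof -
  have "a \<le> \<mu> * a" using assms mult_right_mono[of 1 \<mu> a] by simp
  then have "\<exists>x y. ereal (f a - f a) = ereal (f y - f x) \<and> a \<le> x \<and> x \<le> y \<and> y \<le> \<mu> * x"
    by blast
  then have "Inf {ereal (f y - f x) | x y. a \<le> x \<and> x \<le> y \<and> y \<le> \<mu> * x} \<le> ereal (f a - f a)"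
    by (intro Inf_lower CollectI)
  then show ?thesis by (simp add: nu_bar_def flip: zero_ereal_def)
qed

lemma nu_bar_le_iff:
  "nu_bar a f \<mu> \<le> ereal N \<longleftrightarrow> (\<forall>x y. a \<le> x \<longrightarrow> x \<le> y \<longrightarrow> y \<le> \<mu> * x \<longrightarrow> f y - f x \<ge> - N)"
proof -
  have "nu_bar a f \<mu> \<le> ereal N
      \<longleftrightarrow> ereal (- N) \<le> Inf {ereal (f y - f x) | x y. a \<le> x \<and> x \<le> y \<and> y \<le> \<mu> * x}"
    unfolding nu_bar_def by (simp add: ereal_uminus_le_reorder)
  also have "\<dots> \<longleftrightarrow> (\<forall>x y. a \<le> x \<and> x \<le> y \<and> y \<le> \<mu> * x \<longrightarrow> ereal (- N) \<le> ereal (f y - f x))"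
    unfolding le_Inf_iff by blast
  finally show ?thesis by (simp only: ereal_less_eq) blast
qed

lemma nu_bar_bound:
  assumes "nu_bar a f \<mu> < \<infinity>" "a \<ge> 0" "\<mu> \<ge> 1" "a \<le> x" "x \<le> y" "y \<le> \<mu> * x"
  shows "f y - f x \<ge> - real_of_ereal (nu_bar a f \<mu>)"
proof -
  have "nu_bar a f \<mu> \<le> ereal (real_of_ereal (nu_bar a f \<mu>))"
    using assms(1) nu_bar_nonneg[OF assms(2,3), of f] by (cases "nu_bar a f \<mu>") auto
  then show ?thesis unfolding nu_bar_le_iff using assms by blast
qed

text \<open>A ratio \<mu> is covered by finitely many steps of ratio \<kappa>, and the permitted
  decreases add up.\<close>

lemma boundedly_decreasing_nu_bar:
  assumes bd: "boundedly_decreasing a f" and a: "a > 0"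
  shows "nu_bar a f \<mu> < \<infinity>"
proof -
  obtain \<kappa> where \<kappa>: "\<kappa> > 1" "nu_bar a f \<kappa> < \<infinity>" using bd by (auto simp: boundedly_decreasing_def)
  define N where "N = real_of_ereal (nu_bar a f \<kappa>)"
  have N: "N \<ge> 0" "\<And>x y. a \<le> x \<Longrightarrow> x \<le> y \<Longrightarrow> y \<le> \<kappa> * x \<Longrightarrow> f y - f x \<ge> - N"
    using nu_bar_nonneg[of a \<kappa> f] nu_bar_bound[OF \<kappa>(2)] \<kappa> a
    by (auto simp: N_def real_of_ereal_pos)
  have chain: "f y - f x \<ge> - (real n * N)" if "a \<le> x" "x \<le> y" "y \<le> \<kappa> ^ n * x" for n x y
    using that
  proof (induction n arbitrary: y)
    case (Suc n)
    \<comment> \<open>The last intermediate point is one step of ratio \<kappa> below y, but never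
      to the left of x.\<close>
    define w where "w = max x (y / \<kappa>)"
    have "y / \<kappa> \<le> y" using \<kappa> Suc.prems a by (simp add: field_simps)
    moreover have "y / \<kappa> \<le> \<kappa> ^ n * x" using Suc.prems \<kappa> by (simp add: field_simps)
    moreover have "x \<le> \<kappa> ^ n * x" using \<kappa> Suc.prems a by (simp add: one_le_power)
    ultimately have w: "x \<le> w" "w \<le> y" "w \<le> \<kappa> ^ n * x"
      using Suc.prems by (auto simp: w_def)
    have "y / \<kappa> \<le> w" by (simp add: w_def)
    then have "y \<le> \<kappa> * w" using \<kappa> by (simp add: field_simps)
    then have "f y - f w \<ge> - N" using N(2)[of w y] w Suc.prems by simp
    moreover have "f w - f x \<ge> - (real n * N)" using Suc.IH[of w] w Suc.prems by simp
    ultimately show ?case by (simp add: algebra_simps)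
  qed simp
  obtain n where n: "\<mu> < \<kappa> ^ n" using real_arch_pow[OF \<kappa>(1)] by blast
  have "nu_bar a f \<mu> \<le> ereal (real n * N)"
    unfolding nu_bar_le_iff
  proof (intro allI impI)
    fix x y assume xy: "a \<le> x" "x \<le> y" "y \<le> \<mu> * x"
    have "\<mu> * x \<le> \<kappa> ^ n * x" using n xy a by (intro mult_right_mono) auto
    then show "f y - f x \<ge> - (real n * N)" using chain xy by force
  qed
  then show ?thesis using order_le_less_trans[of _ "ereal (real n * N)" \<infinity>] by simp
qed

section \<open>The transform hypothesis in logarithmic variables\<close>

locale mellin_data =
  fixes m T K1 :: real and A :: "real \<Rightarrow> real"
  assumes m_nonneg: "m \<ge> 0" and T_pos: "T > 0" and K1_pos: "K1 > 0"
    and bv: "locally_bounded_variation A" and A_zero: "\<And>x. x < 1 \<Longrightarrow> A x = 0"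
    and mellin_exists: "\<And>s. Re s > 1 \<Longrightarrow> \<exists>L. has_mellin_stieltjes A s L"
    and mellin_bound: "\<And>\<sigma>. 0 < \<sigma> \<Longrightarrow> \<sigma> < 1 \<Longrightarrow>
         (LBINT t=0..ereal T. cmod (mellin_stieltjes A (Complex (1 + \<sigma>) t)) / cmod (Complex (1 + \<sigma>) t))
           \<le> K1 * (if m > 0 then Z_int m \<sigma> \<infinity> else Z_int 0 \<sigma> (ereal T))"
begin

definition a :: "real \<Rightarrow> real" where "a u = A (exp u) * exp (- u)"

definition b :: "real \<Rightarrow> real \<Rightarrow> real" where "b \<sigma> u = indicator {0..} u * (a u * exp (- (\<sigma> * u)))"

text \<open>The 2 is that of \<open>fejer_convolution_le\<close>.\<close>

definition W :: "real \<Rightarrow> real" where "W y = 2 * K1 * Z_const m (T_dep m T) * growth_fun m y"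

lemma a_growth:
  assumes "\<epsilon> > 0"
  obtains C where "C \<ge> 0" "\<And>u. u \<ge> 0 \<Longrightarrow> \<bar>a u\<bar> \<le> C * exp (\<epsilon> * u)"
proof -
  obtain L where "has_mellin_stieltjes A (of_real (1 + \<epsilon>)) L"
    using mellin_exists[of "of_real (1 + \<epsilon>)"] assms by auto
  then obtain C where C: "\<And>u. u \<ge> 0 \<Longrightarrow> \<bar>A (exp u)\<bar> \<le> C * exp ((1 + \<epsilon>) * u)"
    using mellin_summatory_growth[OF bv A_zero, of "1 + \<epsilon>"] assms by auto
  have "\<bar>a u\<bar> \<le> C * exp (\<epsilon> * u)" if "u \<ge> 0" for u
  proof -
    have "\<bar>a u\<bar> \<le> C * exp ((1 + \<epsilon>) * u) * exp (- u)"
      unfolding a_def abs_mult using C[OF that] by (simp add: mult_right_mono)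
    then show ?thesis by (simp add: mult.assoc algebra_simps flip: exp_add)
  qed
  moreover have "C \<ge> 0" using C[of 0] by simp
  ultimately show ?thesis using that by blast
qed

lemma b_bounded:
  assumes "\<sigma> > 0"
  shows "\<exists>B. \<forall>u. \<bar>b \<sigma> u\<bar> \<le> B"
proof -
  obtain C where C: "C \<ge> 0" "\<And>u. u \<ge> 0 \<Longrightarrow> \<bar>a u\<bar> \<le> C * exp (\<sigma> * u)"
    using a_growth[OF assms] by blast
  have "\<bar>b \<sigma> u\<bar> \<le> C" for u
  proof (cases "u \<ge> 0")
    case True
    have "\<bar>a u\<bar> * exp (- (\<sigma> * u)) \<le> C * exp (\<sigma> * u) * exp (- (\<sigma> * u))"
      using C(2)[OF True] by (intro mult_right_mono) auto
    then show ?thesis using True by (simp add: b_def abs_mult mult.assoc flip: exp_add)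
  qed (use C in \<open>auto simp: b_def\<close>)
  then show ?thesis by blast
qed

text \<open>Growth with exponent \<sigma>/2 leaves the margin \<sigma>/2 for absolute convergence.
  Extension by 0 to negative u turns the Laplace transform on the line Re s = 1 + \<sigma> into a
  Fourier transform.\<close>

lemma
  assumes \<sigma>: "\<sigma> > 0"
  shows b_integrable: "integrable lborel (b \<sigma>)"
    and mellin_eq_fourier: "mellin_stieltjes A (Complex (1 + \<sigma>) t) = Complex (1 + \<sigma>) t * fourier (b \<sigma>) t"
proof -
  define s where "s = Complex (1 + \<sigma>) t"
  obtain C where C: "\<And>u. u \<ge> 0 \<Longrightarrow> \<bar>a u\<bar> \<le> C * exp (\<sigma> / 2 * u)"
    using a_growth[of "\<sigma> / 2"] \<sigma> by auto
  have CA: "\<bar>A (exp u)\<bar> \<le> C * exp ((1 + \<sigma> / 2) * u)" if "u \<ge> 0" for u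
  proof -
    have "\<bar>a u\<bar> * exp u \<le> C * exp (\<sigma> / 2 * u) * exp u"
      using C[OF that] by (intro mult_right_mono) auto
    moreover have "\<bar>a u\<bar> * exp u = \<bar>A (exp u)\<bar>"
      by (simp add: a_def abs_mult mult.assoc flip: exp_add)
    moreover have "exp (\<sigma> / 2 * u) * exp u = exp ((1 + \<sigma> / 2) * u)"
      by (simp add: algebra_simps flip: exp_add)
    ultimately show ?thesis by (simp add: mult.assoc)
  qed
  have ex: "\<exists>L. has_mellin_stieltjes A s L" if "Re s > 1" for s using mellin_exists that by blast
  have e: "indicator {0..} u *\<^sub>R (of_real (A (exp u)) * exp (- (Complex (1 + \<sigma>) t * of_real u)))
      = of_real (b \<sigma> u) * cis (- (t * u))" for t u
  proof -
    have "- (Complex (1 + \<sigma>) t * of_real u) = of_real (- u) + of_real (- (\<sigma> * u)) + \<i> * of_real (- (t * u))"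
      by (simp add: complex_eq_iff algebra_simps)
    then have "exp (- (Complex (1 + \<sigma>) t * of_real u))
        = of_real (exp (- u)) * of_real (exp (- (\<sigma> * u))) * cis (- (t * u))"
      by (simp only: exp_add cis_conv_exp exp_of_real)
    then show ?thesis by (simp add: b_def a_def indicator_def)
  qed
  note M = mellin_stieltjes_eq_laplace[OF bv A_zero _ _ CA ex]
  have "set_integrable lborel {0..} (\<lambda>u. of_real (A (exp u)) * exp (- (Complex (1 + \<sigma>) 0 * of_real u)))"
    by (rule M(1)) (use \<sigma> in auto)
  then have "integrable lborel (\<lambda>u. complex_of_real (b \<sigma> u))"
    unfolding set_integrable_def e by simp
  then show "integrable lborel (b \<sigma>)" by (simp add: complex_of_real_integrable_eq)
  have "mellin_stieltjes A (Complex (1 + \<sigma>) t) = Complex (1 + \<sigma>) t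
      * (LINT u:{0..}|lborel. of_real (A (exp u)) * exp (- (Complex (1 + \<sigma>) t * of_real u)))"
    by (rule M(2)) (use \<sigma> in auto)
  then show "mellin_stieltjes A (Complex (1 + \<sigma>) t) = Complex (1 + \<sigma>) t * fourier (b \<sigma>) t"
    unfolding set_lebesgue_integral_def e fourier_def .
qed

text \<open>The quotient in the hypothesis cancels the factor s that integration by parts produced.
  For m = 1 the condition y \<ge> e reads \<sigma> \<le> 1/e.\<close>

lemma fourier_le_W:
  assumes y: "y > 1" "m = 1 \<Longrightarrow> y \<ge> exp 1"
  shows "2 * (LINT t:{0..T}|lborel. cmod (fourier (b (1 / y)) t)) \<le> W y"
proof -
  define \<sigma> where "\<sigma> = 1 / y"
  have \<sigma>: "0 < \<sigma>" "\<sigma> < 1" "m = 1 \<Longrightarrow> \<sigma> \<le> exp (- 1)" "1 / \<sigma> = y"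
    using y by (auto simp: \<sigma>_def exp_minus field_simps)
  have "(LINT t:{0..T}|lborel. cmod (fourier (b \<sigma>) t))
      = (LBINT t=0..ereal T. cmod (mellin_stieltjes A (Complex (1 + \<sigma>) t)) / cmod (Complex (1 + \<sigma>) t))"
  proof -
    have "cmod (Complex (1 + \<sigma>) t) \<noteq> 0" for t using \<sigma> by (simp add: complex_eq_iff)
    then have "cmod (fourier (b \<sigma>) t) = cmod (mellin_stieltjes A (Complex (1 + \<sigma>) t)) / cmod (Complex (1 + \<sigma>) t)" for t
      by (simp only: mellin_eq_fourier[OF \<sigma>(1)] norm_mult nonzero_mult_div_cancel_left not_False_eq_True)
    then show ?thesis
      using interval_integral_Icc[of 0 T
          "\<lambda>t. cmod (mellin_stieltjes A (Complex (1 + \<sigma>) t)) / cmod (Complex (1 + \<sigma>) t)"] T_pos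
      by (simp only: zero_ereal_def order_less_imp_le)
  qed
  also have "\<dots> \<le> K1 * (Z_const m (T_dep m T) * growth_fun m (1 / \<sigma>))"
    using mellin_bound[OF \<sigma>(1,2)] mult_left_mono[OF Z_bound[OF m_nonneg T_pos \<sigma>(1-3)], of K1] K1_pos
    by linarith
  finally show ?thesis using \<sigma>(4) by (simp add: W_def \<sigma>_def mult_ac)
qed

text \<open>The real \<open>SUP\<close> is informative only for a set bounded above, which
  \<open>a_growth\<close> ensures here.\<close>

lemma sup_ratio_ge:
  assumes "0 \<le> u" "u \<le> U"
  shows "\<bar>a u\<bar> \<le> sup_ratio A (exp U)"
proof -
  obtain C where C: "C \<ge> 0" "\<And>u. u \<ge> 0 \<Longrightarrow> \<bar>a u\<bar> \<le> C * exp (1 * u)"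
    using a_growth[of 1] by auto
  have eq: "A (exp u) / exp u = a u" for u by (simp add: a_def exp_minus divide_inverse)
  have "bdd_above ((\<lambda>x. \<bar>A x / x\<bar>) ` {1..exp U})"
  proof (rule bdd_aboveI2)
    fix x assume x: "x \<in> {1..exp U}"
    then have "\<bar>A x / x\<bar> = \<bar>a (ln x)\<bar>" using eq[of "ln x"] by simp
    also have "\<dots> \<le> C * x" using C(2)[of "ln x"] x by simp
    also have "\<dots> \<le> C * exp U" using x C by (intro mult_left_mono) auto
    finally show "\<bar>A x / x\<bar> \<le> C * exp U" .
  qed
  then have "\<bar>A (exp u) / exp u\<bar> \<le> sup_ratio A (exp U)"
    unfolding sup_ratio_def using assms by (intro cSUP_upper) auto
  then show ?thesis by (simp add: eq)
qed

text \<open>If \<open>S\<close> is the supremum of the weighted function, the kernel estimate at a point where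
  \<open>S\<close> is almost attained reads \<open>S \<le> const + 32/45 S\<close>; \<open>S\<close> is finite, so it can be absorbed.\<close>

lemma b_bootstrap:
  assumes y: "y > 1" "m = 1 \<Longrightarrow> y \<ge> exp 1" and D: "D \<ge> 0"
    and small: "\<And>u. 0 \<le> u \<Longrightarrow> u \<le> Y \<Longrightarrow> \<bar>a u\<bar> \<le> M" and M: "M \<ge> 0" and Y: "Y \<ge> 0"
    and up: "\<And>v u. v > Y \<Longrightarrow> a v > 0 \<Longrightarrow> v \<le> u \<Longrightarrow> u \<le> v + 10 / T \<Longrightarrow> b (1 / y) u \<ge> b (1 / y) v / 2 - D"
    and down: "\<And>v u. v > Y \<Longrightarrow> a v < 0 \<Longrightarrow> v - 10 / T \<le> u \<Longrightarrow> u \<le> v \<Longrightarrow> b (1 / y) u \<le> b (1 / y) v / 2 + D"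
  shows "\<bar>b (1 / y) v\<bar> \<le> M + 8 * D + 2 * W y"
proof -
  define f where "f = b (1 / y)"
  define S where "S = (SUP u. \<bar>f u\<bar>)"
  have \<sigma>: "1 / y > 0" using y by simp
  obtain B where B: "\<And>u. \<bar>f u\<bar> \<le> B" using b_bounded[OF \<sigma>] by (auto simp: f_def)
  have S: "\<bar>f u\<bar> \<le> S" for u
    unfolding S_def by (rule cSUP_upper) (use B in \<open>auto intro!: bdd_aboveI2\<close>)
  have S0: "S \<ge> 0" using S[of 0] by simp
  have fint: "integrable lborel f" unfolding f_def by (rule b_integrable[OF \<sigma>])
  have Wy: "2 * (LINT t:{0..T}|lborel. cmod (fourier f t)) \<le> W y"
    unfolding f_def by (rule fourier_le_W[OF y])
  have W0: "W y \<ge> 0"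
  proof -
    have "0 \<le> (LINT t:{0..T}|lborel. cmod (fourier f t))"
      unfolding set_lebesgue_integral_def by (intro Bochner_Integration.integral_nonneg) auto
    then show ?thesis using Wy by linarith
  qed
  have neg: "fourier (\<lambda>u. - f u) t = - fourier f t" for t
    by (simp add: fourier_def)
  \<comment> \<open>Solving 9/2 (|f v|/2 - D) \<le> W y + 8/5 S for |f v| gives the second entry;
    the first covers v \<le> Y.\<close>
  define X where "X = max M (2 * D + 4 / 9 * (W y + 8 / 5 * S))"
  have key: "\<bar>f v\<bar> \<le> X" for v
  proof -
    consider "v < 0 \<or> f v = 0" | "0 \<le> v" "v \<le> Y" | "v > Y" "f v > 0" | "v > Y" "f v < 0" by linarith
    then show ?thesis
    proof cases
      case 1
      then show ?thesis using M by (auto simp: X_def f_def b_def)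
    next
      case 2
      have "\<bar>f v\<bar> \<le> \<bar>a v\<bar> * 1"
        unfolding f_def b_def abs_mult using 2 y
        by (simp add: indicator_def mult_left_le)
      then show ?thesis using small[OF 2] by (simp add: X_def)
    next
      case 3
      then have av: "a v > 0" using Y by (simp add: f_def b_def zero_less_mult_iff)
      show ?thesis
      \<comment> \<open>The kernel estimate requires a nonnegative level; a negative one already
        means f v < 2 D.\<close>
      proof (cases "f v / 2 - D \<ge> 0")
        case True
        have "9 / 2 * (f v / 2 - D) \<le> 2 * (LINT t:{0..T}|lborel. cmod (fourier f t)) + 8 / 5 * S"
        proof (rule fejer_tauberian_bound[where c = "v + 5 / T"])
          fix u assume "\<bar>u - (v + 5 / T)\<bar> \<le> 5 / T"
          then have "v \<le> u" "u \<le> v + 10 / T" by (auto simp: abs_le_iff)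
          then show "f v / 2 - D \<le> f u" using up[OF 3(1) av] by (simp add: f_def)
        next
          show "- S \<le> f u" for u using S[of u] by linarith
        qed (use fint S T_pos S0 True in auto)
        then have "9 / 2 * (f v / 2 - D) \<le> W y + 8 / 5 * S" using Wy by linarith
        then have "f v \<le> 2 * D + 4 / 9 * (W y + 8 / 5 * S)" by (simp add: field_simps)
        then show ?thesis using 3 unfolding X_def by linarith
      next
        case False
        then have "f v \<le> 2 * D" by simp
        moreover have "0 \<le> 4 / 9 * (W y + 8 / 5 * S)" using W0 S0 by simp
        ultimately show ?thesis using 3 unfolding X_def by linarith
      qed
    next
      case 4
      then have av: "a v < 0" using Y by (simp add: f_def b_def mult_less_0_iff)
      show ?thesis
      proof (cases "- f v / 2 - D \<ge> 0")
        case True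
        have "9 / 2 * (- f v / 2 - D) \<le> 2 * (LINT t:{0..T}|lborel. cmod (fourier (\<lambda>u. - f u) t)) + 8 / 5 * S"
        \<comment> \<open>A limited rate of decrease constrains the past of a negative value, so the
          window ends at v and the estimate is applied to -f.\<close>
        proof (rule fejer_tauberian_bound[where c = "v - 5 / T"])
          fix u assume "\<bar>u - (v - 5 / T)\<bar> \<le> 5 / T"
          then have "v - 10 / T \<le> u" "u \<le> v" by (auto simp: abs_le_iff)
          then have "f u \<le> f v / 2 + D" using down[OF 4(1) av] by (simp add: f_def)
          then show "- f v / 2 - D \<le> - f u" by simp
        next
          show "- S \<le> - f u" for u using S[of u] by linarith
        qed (use fint S T_pos S0 True in auto)
        then have "9 / 2 * (- f v / 2 - D) \<le> W y + 8 / 5 * S"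
          using Wy unfolding neg norm_minus_cancel by linarith
        then have "- f v \<le> 2 * D + 4 / 9 * (W y + 8 / 5 * S)" by (simp add: field_simps)
        then show ?thesis using 4 unfolding X_def by linarith
      next
        case False
        then have "- f v \<le> 2 * D" by simp
        moreover have "0 \<le> 4 / 9 * (W y + 8 / 5 * S)" using W0 S0 by simp
        ultimately show ?thesis using 4 unfolding X_def by linarith
      qed
    qed
  qed
  have "S \<le> X" unfolding S_def by (rule cSUP_least) (use key in auto)
  then consider "S \<le> M" | "S \<le> 2 * D + 4 / 9 * (W y + 8 / 5 * S)"
    unfolding X_def le_max_iff_disj by blast
  then have "S \<le> M + 8 * D + 2 * W y"
  proof cases
    case 2
    \<comment> \<open>The coefficient 32/45 of S leaves 13/45; afterwards 90/13 < 8 and 20/13 <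
      2.\<close>
    then have "13 * S \<le> 90 * D + 20 * W y" by (simp add: field_simps)
    then show ?thesis using M D W0 by linarith
  qed (use D W0 in linarith)
  then show ?thesis using S[of v] by (simp add: f_def)
qed

text \<open>Two factors vary over a window, the power u^q and the weight e^(-u/y), and in each
  direction only one is unfavourable. To the right of a positive value the power helps and the
  weight may halve; to the left of a negative value the weight helps and the power may halve. Hence
  a single factor 1/2, and the maximum in c serves the two cases.\<close>

lemma a_bound_boundedly_decreasing:
  assumes q: "q \<ge> 0" and c: "c = 10 * max 5 (1 + q / ln 2)" and \<nu>: "\<nu> \<ge> 0"
    and F: "\<And>u v. 1 \<le> u \<Longrightarrow> u \<le> v \<Longrightarrow> v \<le> u + 10 / T \<Longrightarrow> a v / v powr q - a u / u powr q \<ge> - \<nu>"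
    and y: "y > 1 + c / T" "m = 1 \<Longrightarrow> y \<ge> exp 1"
  shows "\<bar>a y\<bar> \<le> exp 1 * (sup_ratio A (exp (1 + c / T)) + 8 * (\<nu> * ((1 + q) powr q * y powr q)) + 2 * W y)"
proof -
  define M where "M = sup_ratio A (exp (1 + c / T))"
  define D where "D = \<nu> * ((1 + q) powr q * y powr q)"
  define k where "k = max 5 (1 + q / ln 2)"
  have "k \<ge> 5" "k \<ge> 1 + q / ln 2" unfolding k_def by (rule max.cobounded1, rule max.cobounded2)
  then have c50: "c \<ge> 50" "c \<ge> 10 * (1 + q / ln 2)" by (simp_all add: c k_def[symmetric])
  have cT: "c / T \<ge> 50 / T" using c50 T_pos by (intro divide_right_mono) auto
  have T50: "50 / T > 0" using T_pos by simp
  have y1: "y > 1" using y cT T50 by linarith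
  have M: "\<bar>a u\<bar> \<le> M" if "0 \<le> u" "u \<le> 1 + c / T" for u
    unfolding M_def using sup_ratio_ge that by blast
  have M0: "M \<ge> 0" using M[of 0] cT T50 by (auto intro: order_trans[OF abs_ge_zero])
  \<comment> \<open>From c \<ge> 50: over a window to the right the weight keeps at least 4/5 of its
    size.\<close>
  have win: "10 / T / y \<le> 1 / 5"
  proof -
    have "50 / T \<le> y" using y cT by linarith
    then show ?thesis using T_pos y1 by (simp add: field_simps)
  qed
  have D0: "D \<ge> 0" using \<nu> by (simp add: D_def)
  have Dle: "\<nu> * (u powr q * exp (- (u / y))) \<le> D" if "u \<ge> 0" for u
    unfolding D_def using powr_mult_exp_le[OF q _ that, of y] y1 \<nu> by (intro mult_left_mono) auto
  \<comment> \<open>The threshold Y = 1 + c/T also keeps every left window inside u > 1, where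
    \<open>F\<close> applies.\<close>
  have "\<bar>b (1 / y) y\<bar> \<le> M + 8 * D + 2 * W y"
  proof (rule b_bootstrap[OF y1 y(2) D0 M M0])
    show "0 \<le> 1 + c / T" using cT T50 by linarith
  next
    fix v u assume v: "v > 1 + c / T" and av: "a v > 0" and u: "v \<le> u" "u \<le> v + 10 / T"
    have v1: "v > 1" using v cT T50 by linarith
    have "a v / v powr q - \<nu> \<le> a u / u powr q" using F[of v u] v1 u by simp
    then have "u powr q * (a v / v powr q - \<nu>) \<le> u powr q * (a u / u powr q)"
      by (intro mult_left_mono) auto
    then have "a v * (u powr q / v powr q) - \<nu> * u powr q \<le> a u"
      using v1 u by (simp add: algebra_simps)
    moreover have "a v * 1 \<le> a v * (u powr q / v powr q)"
      using av v1 u q by (intro mult_left_mono) (auto simp: le_divide_eq_1 powr_mono2)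
    ultimately have "a v - \<nu> * u powr q \<le> a u" by simp
    then have "(a v - \<nu> * u powr q) * exp (- (u / y)) \<le> a u * exp (- (u / y))"
      by (intro mult_right_mono) auto
    moreover have "a v * (exp (- (v / y)) * (1 / 2)) \<le> a v * exp (- (u / y))"
    proof (rule mult_left_mono)
      have "(u - v) / y \<le> 10 / T / y" using u y1 by (intro divide_right_mono) auto
      then have "1 / 2 \<le> exp (- ((u - v) / y))"
        using win exp_ge_add_one_self[of "- ((u - v) / y)"] by linarith
      then have "exp (- (v / y)) * (1 / 2) \<le> exp (- (v / y)) * exp (- ((u - v) / y))"
        by (intro mult_left_mono) auto
      also have "\<dots> = exp (- (u / y))" by (simp add: diff_divide_distrib flip: exp_add)
      finally show "exp (- (v / y)) * (1 / 2) \<le> exp (- (u / y))" .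
    qed (use av in auto)
    ultimately have "a v * exp (- (v / y)) / 2 - D \<le> a u * exp (- (u / y))"
      using Dle[of u] v1 u by (simp add: algebra_simps)
    then show "b (1 / y) v / 2 - D \<le> b (1 / y) u" using v1 u by (simp add: b_def)
  next
    fix v u assume v: "v > 1 + c / T" and av: "a v < 0" and u: "v - 10 / T \<le> u" "u \<le> v"
    have cT10: "10 / T \<le> 50 / T" using T_pos by (intro divide_right_mono) auto
    have u1: "u > 1" using v cT u cT10 by linarith
    have "1 / 2 \<le> (u / v) powr q"
    proof (rule powr_quotient_ge_half[OF q])
      have "(v - u) * (1 + q / ln 2) \<le> 10 / T * (1 + q / ln 2)"
        using u q by (intro mult_right_mono) auto
      also have "\<dots> = 10 * (1 + q / ln 2) / T" by simp
      also have "\<dots> \<le> c / T" using c50 T_pos by (intro divide_right_mono) auto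
      finally show "(v - u) * (1 + q / ln 2) \<le> v" using v by linarith
    qed (use u1 u in auto)
    then have half: "1 / 2 \<le> u powr q / v powr q" using u1 u by (simp add: powr_divide)
    have "a u / u powr q \<le> a v / v powr q + \<nu>" using F[of u v] u1 u by simp
    then have "u powr q * (a u / u powr q) \<le> u powr q * (a v / v powr q + \<nu>)"
      by (intro mult_left_mono) auto
    then have "a u \<le> a v * (u powr q / v powr q) + \<nu> * u powr q"
      using u1 by (simp add: algebra_simps)
    moreover have "a v * (u powr q / v powr q) \<le> a v * (1 / 2)"
      using av half by (intro mult_left_mono_neg) auto
    ultimately have "a u \<le> a v * (1 / 2) + \<nu> * u powr q" by linarith
    then have "a u * exp (- (u / y)) \<le> (a v * (1 / 2) + \<nu> * u powr q) * exp (- (u / y))"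
      by (intro mult_right_mono) auto
    moreover have "a v * (1 / 2) * exp (- (u / y)) \<le> a v * (1 / 2) * exp (- (v / y))"
      using av u y1 by (intro mult_left_mono_neg) (auto simp: divide_right_mono)
    ultimately have "a u * exp (- (u / y)) \<le> a v * exp (- (v / y)) / 2 + D"
      using Dle[of u] u1 u by (simp add: algebra_simps)
    then show "b (1 / y) u \<le> b (1 / y) v / 2 + D" using u1 u by (simp add: b_def)
  qed
  moreover have "\<bar>b (1 / y) y\<bar> = \<bar>a y\<bar> * exp (- 1)" using y1 by (simp add: b_def abs_mult)
  ultimately have "exp 1 * (\<bar>a y\<bar> * exp (- 1)) \<le> exp 1 * (M + 8 * D + 2 * W y)"
    by (intro mult_left_mono) auto
  moreover have "exp 1 * (\<bar>a y\<bar> * exp (- 1)) = \<bar>a y\<bar>" by (simp add: exp_minus)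
  ultimately show ?thesis by (simp add: M_def D_def)
qed

text \<open>No supremum has to be absorbed: comparison with u = 0 gives a \<ge> -D outright. For the
  upper bound, a large a(y) persists on [y, y + 10/T] up to one factor l; the further factor e l
  comes from the weight, since u/y \<le> 1 + 10/T there.\<close>

lemma a_bound_moderately_decreasing:
  assumes mod: "moderately_decreasing 1 A B1 B2"
    and y: "y > 1" "m = 1 \<Longrightarrow> y \<ge> exp 1"
  defines "D \<equiv> sup_ratio A (exp 1) + B1 + B2" and "l \<equiv> exp (10 / T)"
  shows "\<bar>a y\<bar> \<le> l * (D + exp 1 * l * (W y + 2 * D))"
proof -
  obtain \<phi> where B: "B1 > 0" "B2 > 0" and \<phi>: "antimono_on {1..} \<phi>" "\<phi> 1 = (1::real)"
    and md: "\<And>v u. v \<ge> 0 \<Longrightarrow> u \<ge> 1 \<Longrightarrow> A (u + v) - A u \<ge> - B1 * v - B2 * max 1 u * \<phi> u"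
    using mod unfolding moderately_decreasing_def by auto
  \<comment> \<open>Monotonicity and \<phi> 1 = 1 give \<phi> \<le> 1; after division by e^v both
    error terms are bounded by constants.\<close>
  have inc: "a v \<ge> a u * exp (- (v - u)) - (B1 + B2)" if uv: "0 \<le> u" "u \<le> v" for u v
  proof -
    have e: "1 \<le> exp u" "exp u \<le> exp v" using uv by auto
    have "\<phi> (exp u) \<le> 1" using \<phi> e monotone_onD[OF \<phi>(1), of 1 "exp u"] by simp
    then have "B2 * exp u * \<phi> (exp u) \<le> B2 * exp u * 1" using B by (intro mult_left_mono) auto
    moreover have "A (exp v) - A (exp u) \<ge> - B1 * (exp v - exp u) - B2 * exp u * \<phi> (exp u)"
      using md[of "exp v - exp u" "exp u"] e by (simp add: max_def)
    moreover have "B1 * (exp v - exp u) \<le> B1 * exp v" "B2 * exp u \<le> B2 * exp v"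
      using B e by (auto intro!: mult_left_mono)
    ultimately have "A (exp u) - (B1 + B2) * exp v \<le> A (exp v)" by (simp add: algebra_simps)
    then have "(A (exp u) - (B1 + B2) * exp v) * exp (- v) \<le> a v"
      unfolding a_def by (intro mult_right_mono) auto
    moreover have "(A (exp u) - (B1 + B2) * exp v) * exp (- v) = A (exp u) * exp (- v) - (B1 + B2)"
      by (simp add: left_diff_distrib mult.assoc flip: exp_add)
    moreover have "A (exp u) * exp (- v) = a u * exp (- (v - u))"
      by (simp add: a_def mult.assoc flip: exp_add)
    ultimately show ?thesis by simp
  qed
  have sup: "\<bar>a 0\<bar> \<le> sup_ratio A (exp 1)" by (rule sup_ratio_ge) auto
  then have D0: "D \<ge> 0" using B by (simp add: D_def)
  have low: "a v \<ge> - D" if "v \<ge> 0" for v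
  proof -
    have "- \<bar>a 0\<bar> \<le> - \<bar>a 0\<bar> * exp (- v)" using that by (simp add: mult_left_le)
    also have "\<dots> \<le> a 0 * exp (- v)" by (intro mult_right_mono) auto
    finally show ?thesis using inc[of 0 v] that sup by (simp add: D_def)
  qed
  have T10: "10 / T > 0" using T_pos by simp
  have l: "l \<ge> 1" using T10 by (simp add: l_def)
  have bB: "\<exists>B. \<forall>u. \<bar>b (1 / y) u\<bar> \<le> B" by (rule b_bounded) (use y in auto)
  then obtain B where B: "\<And>u. \<bar>b (1 / y) u\<bar> \<le> B" by blast
  have Wy: "2 * (LINT t:{0..T}|lborel. cmod (fourier (b (1 / y)) t)) \<le> W y"
    by (rule fourier_le_W[OF y])
  have W0: "W y \<ge> 0"
  proof -
    have "0 \<le> (LINT t:{0..T}|lborel. cmod (fourier (b (1 / y)) t))"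
      unfolding set_lebesgue_integral_def by (intro Bochner_Integration.integral_nonneg) auto
    then show ?thesis using Wy by linarith
  qed
  have rest: "0 \<le> exp 1 * l * (W y + 2 * D)" using W0 D0 l by (intro mult_nonneg_nonneg) auto
  have upper: "a y \<le> l * (D + exp 1 * l * (W y + 2 * D))"
  proof (cases "a y \<le> l * D")
    case True
    have "l * D \<le> l * (D + exp 1 * l * (W y + 2 * D))" using rest l by (intro mult_left_mono) auto
    then show ?thesis using True by simp
  next
    case False
    \<comment> \<open>A lower bound for \<open>a\<close> on the window starting at y, nonnegative
      because a y > l D in this case.\<close>
    define p where "p = a y / l - D"
    define r where "r = p * (exp (- 1) / l)"
    have p: "p \<ge> 0" using False l by (simp add: p_def field_simps)
    have "9 / 2 * (p * (exp (- 1) / l))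
        \<le> 2 * (LINT t:{0..T}|lborel. cmod (fourier (b (1 / y)) t)) + 8 / 5 * D"
    proof (rule fejer_tauberian_bound[where c = "y + 5 / T"])
      show "integrable lborel (b (1 / y))" by (rule b_integrable) (use y in auto)
      show "0 \<le> p * (exp (- 1) / l)" using p l by simp
      show "- D \<le> b (1 / y) u" for u
      proof (cases "u \<ge> 0")
        case True
        have "- D \<le> - D * exp (- (u / y))" using True y D0 by (simp add: mult_left_le)
        also have "\<dots> \<le> a u * exp (- (u / y))" using low[OF True] by (intro mult_right_mono) auto
        finally show ?thesis using True by (simp add: b_def)
      qed (use D0 in \<open>simp add: b_def\<close>)
      fix u assume "\<bar>u - (y + 5 / T)\<bar> \<le> 5 / T"
      then have u: "y \<le> u" "u \<le> y + 10 / T" by (auto simp: abs_le_iff)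
      have ay: "a y \<ge> 0" using False D0 l by (smt (verit) mult_nonneg_nonneg)
      have "a y / l = a y * exp (- (10 / T))" by (simp add: l_def exp_minus divide_inverse)
      also have "\<dots> \<le> a y * exp (- (u - y))" using u ay by (intro mult_left_mono) auto
      also have "\<dots> \<le> a u + (B1 + B2)" using inc[of y u] u y by simp
      finally have "p \<le> a u" using sup by (simp add: p_def D_def)
      moreover have "exp (- 1) / l \<le> exp (- (u / y))"
      proof -
        have "(u - y) / y \<le> (u - y) / 1" using u y by (intro divide_left_mono) auto
        then have "u / y - 1 \<le> 10 / T" using u y by (simp add: diff_divide_distrib)
        then have "exp (- 1 - 10 / T) \<le> exp (- (u / y))" by simp
        then show ?thesis by (simp add: exp_diff l_def)
      qed
      ultimately have "p * (exp (- 1) / l) \<le> a u * exp (- (u / y))"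
        using p l by (intro mult_mono) auto
      then show "p * (exp (- 1) / l) \<le> b (1 / y) u" using u y by (simp add: b_def)
    qed (use B D0 T_pos in auto)
    then have "r \<le> W y + 2 * D"
      unfolding r_def[symmetric] using Wy D0 W0 by linarith
    then have "p * (exp (- 1) / l) \<le> W y + 2 * D" by (simp only: r_def)
    then have "exp 1 * l * (p * (exp (- 1) / l)) \<le> exp 1 * l * (W y + 2 * D)"
      using l by (intro mult_left_mono) auto
    moreover have "exp 1 * l * (p * (exp (- 1) / l)) = p" using l by (simp add: exp_minus)
    ultimately have "a y / l \<le> D + exp 1 * l * (W y + 2 * D)" by (simp add: p_def)
    then show ?thesis using l by (simp add: field_simps)
  qed
  have "D \<le> D + exp 1 * l * (W y + 2 * D)" using rest by simp
  also have "\<dots> \<le> l * (D + exp 1 * l * (W y + 2 * D))"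
    using mult_right_mono[of 1 l "D + exp 1 * l * (W y + 2 * D)"] l D0 rest by simp
  finally have "- a y \<le> l * (D + exp 1 * l * (W y + 2 * D))" using low[of y] y by simp
  with upper show ?thesis by (rule abs_leI)
qed

lemma growth_boundI:
  assumes "\<And>y. y \<ge> 1 \<Longrightarrow> (m = 1 \<Longrightarrow> y \<ge> exp 1) \<Longrightarrow> \<bar>a y\<bar> \<le> C * growth_fun m y"
  shows "growth_bound m A C"
proof -
  have eq: "\<bar>A x\<bar> = x * \<bar>a (ln x)\<bar>" if "x > 0" for x
    using that by (simp add: a_def abs_mult exp_minus)
  have *: "\<bar>A x\<bar> \<le> C * x * growth_fun m (ln x)" if "x > 0" "ln x \<ge> 1" "m = 1 \<Longrightarrow> ln x \<ge> exp 1" for x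
  proof -
    have "x * \<bar>a (ln x)\<bar> \<le> x * (C * growth_fun m (ln x))"
      using assms[of "ln x"] that by (intro mult_left_mono) auto
    then show ?thesis using eq[OF that(1)] by (simp add: mult_ac)
  qed
  show ?thesis
  proof (cases "m = 1")
    case True
    have "\<bar>A x\<bar> \<le> C * x * ln (ln x)" if x: "x \<ge> exp (exp 1)" for x
    proof -
      have x0: "x > 0" using x exp_gt_zero by (rule less_le_trans[rotated])
      have "exp 1 \<le> ln x" using x x0 by (simp add: ln_ge_iff)
      moreover from this have "1 \<le> ln x" using exp_ge_add_one_self[of 1] by linarith
      ultimately show ?thesis using *[OF x0] True by (simp add: growth_fun_def)
    qed
    then show ?thesis using True by (simp add: growth_bound_def)
  next
    case False
    have "\<bar>A x\<bar> \<le> C * x * ln x powr pos_part (m - 1)" if x: "x \<ge> exp 1" for x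
    proof -
      have x0: "x > 0" using x exp_gt_zero by (rule less_le_trans[rotated])
      have "1 \<le> ln x" using x x0 by (simp add: ln_ge_iff)
      then show ?thesis using *[OF x0] False by (simp add: growth_fun_def)
    qed
    then show ?thesis using False by (simp add: growth_bound_def)
  qed
qed

lemma Z_const_nonneg: "Z_const m (T_dep m T) \<ge> 0"
  using m_nonneg T_pos by (simp add: Z_const_def T_dep_def)

text \<open>q = 0 is condition (1), where c becomes 50, and q = (m-2)_+ is condition (2). The
  permitted decrease contributes y^q, which the order of growth dominates: q = m - 2 < m - 1
  whenever q is nonzero.\<close>

lemma growth_bound_boundedly_decreasing:
  assumes q: "q = 0 \<or> q = pos_part (m - 2)" and c: "c = 10 * max 5 (1 + q / ln 2)" and \<nu>: "\<nu> \<ge> 0"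
    and F: "\<And>u v. 1 \<le> u \<Longrightarrow> u \<le> v \<Longrightarrow> v \<le> u + 10 / T \<Longrightarrow> a v / v powr q - a u / u powr q \<ge> - \<nu>"
  shows "growth_bound m A (exp 1 * (sup_ratio A (exp (1 + c / T)) + 8 * (\<nu> * (1 + q) powr q)
           + 4 * K1 * Z_const m (T_dep m T)))"
    (is "growth_bound m A (exp 1 * (?M + ?N + ?K))")
proof (rule growth_boundI)
  fix y :: real assume y: "y \<ge> 1" "m = 1 \<Longrightarrow> y \<ge> exp 1"
  have q0: "q \<ge> 0" using q by (auto simp: pos_part_def)
  have E1: "growth_fun m y \<ge> 1" by (rule growth_fun_ge_1) (use y in auto)
  have yq: "y powr q \<le> growth_fun m y"
  proof (cases "q = 0")
    case True
    then show ?thesis using E1 y by simp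
  next
    case False
    then have "q = m - 2" "m > 2" using q by (auto simp: pos_part_def max_def split: if_splits)
    then show ?thesis using y by (auto simp: growth_fun_def pos_part_def intro!: powr_mono)
  qed
  have c0: "c / T \<ge> 0" using T_pos q0 by (auto simp: c max_def)
  have M0: "?M \<ge> 0" using sup_ratio_ge[of 0 "1 + c / T"] c0 by (auto intro: order_trans[OF abs_ge_zero])
  have N0: "?N \<ge> 0" using \<nu> by simp
  have K0: "?K \<ge> 0" using K1_pos Z_const_nonneg by simp
  show "\<bar>a y\<bar> \<le> exp 1 * (?M + ?N + ?K) * growth_fun m y"
  \<comment> \<open>On the initial segment the supremum alone suffices, since
    \<open>growth_fun\<close> is at least 1.\<close>
  proof (cases "y \<le> 1 + c / T")
    case True
    have "\<bar>a y\<bar> \<le> 1 * ?M * 1" using sup_ratio_ge[of y] True y by simp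
    also have "\<dots> \<le> exp 1 * (?M + ?N + ?K) * growth_fun m y"
      using M0 N0 K0 E1 by (intro mult_mono) auto
    finally show ?thesis .
  next
    case False
    have "\<bar>a y\<bar> \<le> exp 1 * (?M + 8 * (\<nu> * ((1 + q) powr q * y powr q)) + 2 * W y)"
      using a_bound_boundedly_decreasing[OF q0 c \<nu> F] False y by simp
    also have "?M + 8 * (\<nu> * ((1 + q) powr q * y powr q)) + 2 * W y
        = ?M * 1 + ?N * y powr q + ?K * growth_fun m y"
      by (simp add: W_def algebra_simps)
    also have "\<dots> \<le> ?M * growth_fun m y + ?N * growth_fun m y + ?K * growth_fun m y"
      using M0 N0 E1 yq by (intro add_mono mult_left_mono order_refl) auto
    also have "\<dots> = (?M + ?N + ?K) * growth_fun m y" by (simp add: algebra_simps)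
    finally show ?thesis by (simp add: mult.assoc)
  qed
qed

lemma growth_bound_moderately_decreasing:
  assumes mod: "moderately_decreasing 1 A B1 B2"
  shows "growth_bound m A (exp (10 / T) * ((sup_ratio A (exp 1) + B1 + B2) + exp 1 * exp (10 / T) *
      (2 * K1 * Z_const m (T_dep m T) + 2 * (sup_ratio A (exp 1) + B1 + B2))))"
    (is "growth_bound m A (?l * (?D + exp 1 * ?l * (?K + 2 * ?D)))")
proof (rule growth_boundI)
  fix y :: real assume y: "y \<ge> 1" "m = 1 \<Longrightarrow> y \<ge> exp 1"
  have E1: "growth_fun m y \<ge> 1" by (rule growth_fun_ge_1) (use y in auto)
  have B: "B1 > 0" "B2 > 0" using mod by (auto simp: moderately_decreasing_def)
  have M: "\<bar>a u\<bar> \<le> ?D" if "0 \<le> u" "u \<le> 1" for u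
    using sup_ratio_ge[OF that] B by simp
  then have D0: "?D \<ge> 0" using M[of 0] abs_ge_zero[of "a 0"] by linarith
  have K0: "?K \<ge> 0" using K1_pos Z_const_nonneg by simp
  have l: "?l \<ge> 1" using T_pos by simp
  show "\<bar>a y\<bar> \<le> ?l * (?D + exp 1 * ?l * (?K + 2 * ?D)) * growth_fun m y"
  \<comment> \<open>y = 1 would mean \<sigma> = 1, outside the range of the transform
    hypothesis.\<close>
  proof (cases "y = 1")
    case True
    have "\<bar>a y\<bar> \<le> 1 * (?D + 0) * 1" using M[of 1] True by simp
    also have "\<dots> \<le> ?l * (?D + exp 1 * ?l * (?K + 2 * ?D)) * growth_fun m y"
      using D0 K0 E1 l by (intro mult_mono add_mono) auto
    finally show ?thesis .
  next
    case False
    have "\<bar>a y\<bar> \<le> ?l * (?D * 1 + exp 1 * ?l * (?K * growth_fun m y + 2 * ?D * 1))"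
      using a_bound_moderately_decreasing[OF mod, of y] y False by (simp add: W_def)
    also have "\<dots> \<le> ?l * (?D * growth_fun m y + exp 1 * ?l * (?K * growth_fun m y + 2 * ?D * growth_fun m y))"
      using D0 K0 E1 l by (intro mult_left_mono add_mono order_refl) auto
    also have "\<dots> = ?l * (?D + exp 1 * ?l * (?K + 2 * ?D)) * growth_fun m y"
      by (simp add: algebra_simps)
    finally show ?thesis .
  qed
qed

end

section \<open>Explicit constants and the conclusion\<close>

definition const_bounded_decrease :: "real \<Rightarrow> real \<Rightarrow> real \<Rightarrow> real option \<Rightarrow> real \<Rightarrow> ereal \<Rightarrow> real" where
  "const_bounded_decrease q m K t M \<nu> =
     exp 1 * (M + 8 * (real_of_ereal \<nu> * (1 + q) powr q) + 4 * K * Z_const m t)"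

definition const_moderate_decrease ::
  "real \<Rightarrow> real \<Rightarrow> real option \<Rightarrow> real \<Rightarrow> real \<Rightarrow> real \<Rightarrow> real \<Rightarrow> real" where
  "const_moderate_decrease m K t M l B1 B2 =
     l * ((M + B1 + B2) + exp 1 * l * (2 * K * Z_const m t + 2 * (M + B1 + B2)))"

theorem theorem4p1:
  shows "\<exists>(C1 :: real \<Rightarrow> real \<Rightarrow> real option \<Rightarrow> real \<Rightarrow> ereal \<Rightarrow> real)
          (C2 :: real \<Rightarrow> real \<Rightarrow> real option \<Rightarrow> real \<Rightarrow> ereal \<Rightarrow> real)
          (C3 :: real \<Rightarrow> real \<Rightarrow> real option \<Rightarrow> real \<Rightarrow> real \<Rightarrow> real \<Rightarrow> real \<Rightarrow> real).
    \<forall>(m :: real) (T :: real) (A :: real \<Rightarrow> real) (K1 :: real).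
      m \<ge> 0 \<longrightarrow> T > 0 \<longrightarrow> K1 > 0 \<longrightarrow>
      locally_bounded_variation A \<longrightarrow> (\<forall>x<1. A x = 0) \<longrightarrow>
      (\<forall>s. Re s > 1 \<longrightarrow> (\<exists>L. has_mellin_stieltjes A s L)) \<longrightarrow>
      (\<forall>\<sigma>. 0 < \<sigma> \<and> \<sigma> < 1 \<longrightarrow>
         (LBINT t=0..ereal T. cmod (mellin_stieltjes A (Complex (1 + \<sigma>) t)) / cmod (Complex (1 + \<sigma>) t))
           \<le> K1 * (if m > 0 then Z_int m \<sigma> \<infinity> else Z_int 0 \<sigma> (ereal T))) \<longrightarrow>
      (boundedly_decreasing 1 (\<lambda>x. A x / x) \<longrightarrow>
         growth_bound m A
           (C1 m K1 (T_dep m T)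
              (sup_ratio A (exp (1 + 50 / T)))
              (nu_bar 1 (\<lambda>x. A x / x) (exp (10 / T))))) \<and>
      (boundedly_decreasing (exp 1) (\<lambda>x. A x / (x * ln x powr pos_part (m - 2))) \<longrightarrow>
         growth_bound m A
           (C2 m K1 (T_dep m T)
              (sup_ratio A (exp (1 + 10 * max 5 (1 + pos_part (m - 2) / ln 2) / T)))
              (nu_bar (exp 1) (\<lambda>x. A x / (x * ln x powr pos_part (m - 2))) (exp (10 / T))))) \<and>
      (\<forall>B1 B2. moderately_decreasing 1 A B1 B2 \<longrightarrow>
         growth_bound m A
           (C3 m K1 (T_dep m T) (sup_ratio A (exp 1)) (exp (10 / T)) B1 B2))"
\<comment> \<open>The first two witnesses are one function at q = 0 and q = (m-2)_+. Being fixed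
  before T and A, the witnesses can depend on them only through their listed arguments.\<close>
proof (rule exI[of _ "const_bounded_decrease 0"],
    rule exI[of _ "\<lambda>m. const_bounded_decrease (pos_part (m - 2)) m"],
    rule exI[of _ const_moderate_decrease], intro allI impI)
  fix m T :: real and A :: "real \<Rightarrow> real" and K1 :: real
  assume "m \<ge> 0" "T > 0" "K1 > 0" "locally_bounded_variation A" "\<forall>x<1. A x = 0"
    "\<forall>s. Re s > 1 \<longrightarrow> (\<exists>L. has_mellin_stieltjes A s L)"
    "\<forall>\<sigma>. 0 < \<sigma> \<and> \<sigma> < 1 \<longrightarrow>
         (LBINT t=0..ereal T. cmod (mellin_stieltjes A (Complex (1 + \<sigma>) t)) / cmod (Complex (1 + \<sigma>) t))
           \<le> K1 * (if m > 0 then Z_int m \<sigma> \<infinity> else Z_int 0 \<sigma> (ereal T))"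
  then interpret mellin_data m T K1 A
    by unfold_locales (simp_all only: order_refl)
  have l: "exp (10 / T) \<ge> 1" using T_pos by simp
  \<comment> \<open>A window of length 10/T in u is the ratio e^(10/T) in x, and u \<ge> 1 is x
    \<ge> e, the domain of condition (2).\<close>
  have win: "1 \<le> exp u" "exp u \<le> exp v" "exp v \<le> exp (10 / T) * exp u"
    if "1 \<le> u" "u \<le> v" "v \<le> u + 10 / T" for u v :: real
    using that by (simp_all flip: exp_add)
  have a: "A (exp u) / exp u = a u" for u by (simp add: a_def exp_minus divide_inverse)
  have C1: "growth_bound m A (const_bounded_decrease 0 m K1 (T_dep m T) (sup_ratio A (exp (1 + 50 / T)))
      (nu_bar 1 (\<lambda>x. A x / x) (exp (10 / T))))"
    if bd: "boundedly_decreasing 1 (\<lambda>x. A x / x)"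
    unfolding const_bounded_decrease_def
  proof (rule growth_bound_boundedly_decreasing)
    show "0 \<le> real_of_ereal (nu_bar 1 (\<lambda>x. A x / x) (exp (10 / T)))"
      using nu_bar_nonneg[OF _ l] by (simp add: real_of_ereal_pos)
    fix u v assume uv: "1 \<le> u" "u \<le> v" "v \<le> u + 10 / T"
    have "A (exp v) / exp v - A (exp u) / exp u
        \<ge> - real_of_ereal (nu_bar 1 (\<lambda>x. A x / x) (exp (10 / T)))"
      by (rule nu_bar_bound[OF boundedly_decreasing_nu_bar[OF bd] _ l]) (use win[OF uv] in auto)
    then show "- real_of_ereal (nu_bar 1 (\<lambda>x. A x / x) (exp (10 / T))) \<le> a v / v powr 0 - a u / u powr 0"
      using uv by (simp add: a)
  qed auto
  define q where "q = pos_part (m - 2)"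
  define f where "f x = A x / (x * ln x powr q)" for x
  have C2: "growth_bound m A (const_bounded_decrease q m K1 (T_dep m T)
      (sup_ratio A (exp (1 + 10 * max 5 (1 + q / ln 2) / T)))
      (nu_bar (exp 1) f (exp (10 / T))))"
    if bd: "boundedly_decreasing (exp 1) f"
    unfolding const_bounded_decrease_def
  proof (rule growth_bound_boundedly_decreasing)
    show "0 \<le> real_of_ereal (nu_bar (exp 1) f (exp (10 / T)))"
      using nu_bar_nonneg[OF _ l] by (simp add: real_of_ereal_pos)
    fix u v assume uv: "1 \<le> u" "u \<le> v" "v \<le> u + 10 / T"
    have fa: "f (exp w) = a w / w powr q" for w
      using a[of w] by (simp add: f_def flip: divide_divide_eq_left)
    have "f (exp v) - f (exp u) \<ge> - real_of_ereal (nu_bar (exp 1) f (exp (10 / T)))"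
      by (rule nu_bar_bound[OF boundedly_decreasing_nu_bar[OF bd] _ l]) (use win[OF uv] uv in auto)
    then show "- real_of_ereal (nu_bar (exp 1) f (exp (10 / T))) \<le> a v / v powr q - a u / u powr q"
      by (simp add: fa)
  qed (auto simp: q_def)
  have C3: "growth_bound m A (const_moderate_decrease m K1 (T_dep m T) (sup_ratio A (exp 1)) (exp (10 / T)) B1 B2)"
    if "moderately_decreasing 1 A B1 B2" for B1 B2
    unfolding const_moderate_decrease_def by (rule growth_bound_moderately_decreasing[OF that])
  show "(boundedly_decreasing 1 (\<lambda>x. A x / x) \<longrightarrow>
         growth_bound m A
           (const_bounded_decrease 0 m K1 (T_dep m T)
              (sup_ratio A (exp (1 + 50 / T)))
              (nu_bar 1 (\<lambda>x. A x / x) (exp (10 / T))))) \<and>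
      (boundedly_decreasing (exp 1) (\<lambda>x. A x / (x * ln x powr pos_part (m - 2))) \<longrightarrow>
         growth_bound m A
           (const_bounded_decrease (pos_part (m - 2)) m K1 (T_dep m T)
              (sup_ratio A (exp (1 + 10 * max 5 (1 + pos_part (m - 2) / ln 2) / T)))
              (nu_bar (exp 1) (\<lambda>x. A x / (x * ln x powr pos_part (m - 2))) (exp (10 / T))))) \<and>
      (\<forall>B1 B2. moderately_decreasing 1 A B1 B2 \<longrightarrow>
         growth_bound m A
           (const_moderate_decrease m K1 (T_dep m T) (sup_ratio A (exp 1)) (exp (10 / T)) B1 B2))"
    using C1 C2[unfolded f_def[abs_def] q_def] C3 by (intro conjI impI allI)
qed

end
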